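(* Let $S$ be a non-densely defined (closed) regular symmetric operator in $\mathcal H$ with non-zero semi-deficiency indices, and for $\lambda,z\in\mathbb C_+$ let $C^S_\lambda(z)\in\mathbf B(\mathfrak N_\lambda,\mathfrak N_{\bar\lambda})$ and $C^{S_0}_\lambda(z)\in\mathbf B(\mathfrak N'_\lambda,\mathfrak N'_{\bar\lambda})$ be the characteristic functions of $S$ and $S_0$, respectively. Write $$C^S_\lambda(z)=\begin{bmatrix}A^{(\lambda)}_{11}(z)&A^{(\lambda)}_{12}(z)\\ A^{(\lambda)}_{21}(z)&A^{(\lambda)}_{22}(z)\end{bmatrix}:\ \mathfrak L_\lambda\oplus\mathfrak N'_\lambda\to\mathfrak L_{\bar\lambda}\oplus\mathfrak N'_{\bar\lambda},$$ where $A^{(\lambda)}_{11}(z)=P_{\mathfrak L_{\bar\lambda}}C^S_\lambda(z)\upharpoonright\mathfrak L_\lambda$, $A^{(\lambda)}_{12}(z)=P_{\mathfrak L_{\bar\lambda}}C^S_\lambda(z)\upharpoonright\mathfrak N'_\lambda$, $A^{(\lambda)}_{21}(z)=P_{\mathfrak N'_{\bar\lambda}}C^S_\lambda(z)\upharpoonright\mathfrak L_\lambda$, $A^{(\lambda)}_{22}(z)=P_{\mathfrak N'_{\bar\lambda}}C^S_\lambda(z)\upharpoonright\mathfrak N'_\lambda$. Then $C^{S_0}_\lambda(z)$ is the Schur complement of the block operator-matrix function $$C^S_\lambda(z)-V_\lambda P_{\mathfrak L_\lambda}=\begin{bmatrix}A^{(\lambda)}_{11}(z)-V_\lambda&A^{(\lambda)}_{12}(z)\\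 A^{(\lambda)}_{21}(z)&A^{(\lambda)}_{22}(z)\end{bmatrix},$$ i.e. for every $z\in\mathbb C_+$ $$C^{S_0}_\lambda(z)=A^{(\lambda)}_{22}(z)-A^{(\lambda)}_{21}(z)\big(A^{(\lambda)}_{11}(z)-V_\lambda\big)^{-1}A^{(\lambda)}_{12}(z)$$ and $$C^S_\lambda(z)-V_\lambda P_{\mathfrak L_\lambda}=\begin{bmatrix}I_{\mathfrak L_{\bar\lambda}}&0\\ A^{(\lambda)}_{21}(z)(A^{(\lambda)}_{11}(z)-V_\lambda)^{-1}&I_{\mathfrak N'_{\bar\lambda}}\end{bmatrix}\begin{bmatrix}A^{(\lambda)}_{11}(z)-V_\lambda&0\\0&C^{S_0}_\lambda(z)\end{bmatrix}\begin{bmatrix}I_{\mathfrak L_\lambda}&(A^{(\lambda)}_{11}(z)-V_\lambda)^{-1}A^{(\lambda)}_{12}(z)\\0&I_{\mathfrak N'_\lambda}\end{bmatrix}.$$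
   Context: $\mathcal H$ is an infinite-dimensional complex separable Hilbert space; $P_{\mathfrak K}$ is the orthogonal projection onto $\mathfrak K$; $\dot+$ is the direct sum of linear manifolds; $\mathbf B(H_1,H_2)$ is the space of bounded operators; $\mathbb C_+$ is the open upper half-plane. $S$ is symmetric if $\operatorname{Im}(Sf,f)=0$ on $\operatorname{dom}S$. For a closed non-densely defined symmetric $S$: $\mathcal H_0=\overline{\operatorname{dom}}\,S$, $\mathfrak L=\mathcal H\ominus\mathcal H_0$, $S_0=P_{\mathcal H_0}S$ (a densely defined symmetric operator in $\mathcal H_0$ with domain $\operatorname{dom}S$). For $\lambda\in\mathbb C\setminus\mathbb R$: $\mathfrak N_\lambda=\mathcal H\ominus\operatorname{ran}(S-\bar\lambda I)$, $\mathfrak L_\lambda=P_{\mathfrak N_\lambda}\mathfrak L$, $\mathfrak N'_\lambda=\mathfrak N_\lambda\ominus\mathfrak L_\lambda$ (equal to the deficiency subspace $\mathcal H_0\ominus\operatorname{ran}(S_0-\bar\lambda I)$ of $S_0$ in $\mathcal H_0$); the semi-deficiency indices are $n'_\pm=\dim\mathfrak N'_\lambda$ for $\lambda\in\mathbb C_\pm$. $V_\lambda:\mathfrak L_\lambda\to\mathfrak L_{\bar\lambda}$ is the isometry $V_\lambda P_{\mathfrak N_\lambda}h=P_{\mathfrak N_{\bar\lambda}}h$, $h\in\mathfrak L$. $S$ is regular if $S_0$ is closed (then all $\mathfrak L_\lambda$ are closed). The Shtraus extension of $S$ for $z\in\mathbb C_+$ is the maximal dissipative operator $\operatorname{dom}\widetilde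 S_z=\operatorname{dom}S\dot+\mathfrak N_z$, $\widetilde S_z(f_S+\varphi_z)=Sf_S+z\varphi_z$, and the characteristic function of $S$ is $C^S_\lambda(z)=(\widetilde S_z-\lambda I)(\widetilde S_z-\bar\lambda I)^{-1}\upharpoonright\mathfrak N_\lambda$. The characteristic function $C^{S_0}_\lambda(z)$ is defined in the same way for $S_0$ in $\mathcal H_0$: with $\operatorname{dom}(\widetilde{S_0})_z=\operatorname{dom}S_0\dot+\mathfrak N'_z$, $(\widetilde{S_0})_z(f+\varphi'_z)=S_0f+z\varphi'_z$, one sets $C^{S_0}_\lambda(z)=((\widetilde{S_0})_z-\lambda I)((\widetilde{S_0})_z-\bar\lambda I)^{-1}\upharpoonright\mathfrak N'_\lambda$. *)

theory Defs
  imports "HOL-Analysis.Analysis" "HOL-Library.Extended_Nat"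
begin

section \<open>Complex Hilbert spaces\<close>

text \<open>The inner product is linear in the first argument.\<close>

class complex_inner = real_normed_vector +
  fixes scaleC :: "complex \<Rightarrow> 'a \<Rightarrow> 'a"  (infixr \<open>*\<^sub>C\<close> 75)
    and cinner :: "'a \<Rightarrow> 'a \<Rightarrow> complex"
  assumes scaleC_add_right: "c *\<^sub>C (x + y) = c *\<^sub>C x + c *\<^sub>C y"
    and scaleC_add_left: "(c + d) *\<^sub>C x = c *\<^sub>C x + d *\<^sub>C x"
    and scaleC_scaleC: "c *\<^sub>C (d *\<^sub>C x) = (c * d) *\<^sub>C x"
    and scaleC_one: "1 *\<^sub>C x = x"
    and scaleR_scaleC: "r *\<^sub>R x = complex_of_real r *\<^sub>C x"
    and cinner_commute: "cinner x y = cnj (cinner y x)"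
    and cinner_add_left: "cinner (x + y) w = cinner x w + cinner y w"
    and cinner_scaleC_left: "cinner (c *\<^sub>C x) y = c * cinner x y"
    and norm_eq_sqrt_cinner: "norm x = sqrt (Re (cinner x x))"

class complex_hilbert = complex_inner + complete_space

global_interpretation cvec: vector_space "scaleC :: complex \<Rightarrow> 'a \<Rightarrow> 'a::complex_inner"
  by unfold_locales (simp_all add: scaleC_add_right scaleC_add_left scaleC_scaleC scaleC_one)

definition separable :: "'a::complex_hilbert itself \<Rightarrow> bool" where
  "separable _ \<longleftrightarrow> (\<exists>D::'a set. countable D \<and> closure D = UNIV)"

definition infinite_dimensional :: "'a::complex_hilbert itself \<Rightarrow> bool" where
  "infinite_dimensional _ \<longleftrightarrow> \<not> (\<exists>B::'a set. finite B \<and> cvec.span B = UNIV)"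

text \<open>
  The dimension as an extended natural number.  For closed subspaces of a separable space
  this is the Hilbert dimension, with countably infinite dimension rendered as \<open>\<infinity>\<close>.
\<close>

definition hdim :: "'a::complex_inner set \<Rightarrow> enat" where
  "hdim M = (SUP B \<in> {B. B \<subseteq> M \<and> finite B \<and> cvec.independent B}. enat (card B))"

text \<open>\<open>ominus K M\<close> is the relative orthogonal complement of \<open>M\<close> in \<open>K\<close>.\<close>

definition ominus :: "'a::complex_inner set \<Rightarrow> 'a set \<Rightarrow> 'a set" where
  "ominus K M = {x \<in> K. \<forall>y\<in>M. cinner x y = 0}"

text \<open>The orthogonal projection; meaningful when \<open>K\<close> is a closed subspace.\<close>

definition proj :: "'a::complex_inner set \<Rightarrow> 'a \<Rightarrow> 'a" where
  "proj K x = (THE y. y \<in> K \<and> x - y \<in> ominus UNIV K)"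

text \<open>\<open>T\<close> restricts to an element of \<open>B(M, K)\<close>; values outside \<open>M\<close> are ignored.\<close>

definition bounded_operators :: "'a::complex_inner set \<Rightarrow> 'a set \<Rightarrow> ('a \<Rightarrow> 'a) set" where
  "bounded_operators M K = {T. T \<in> M \<rightarrow> K
     \<and> (\<forall>x\<in>M. \<forall>y\<in>M. T (x + y) = T x + T y)
     \<and> (\<forall>c. \<forall>x\<in>M. T (c *\<^sub>C x) = c *\<^sub>C T x)
     \<and> (\<exists>b. \<forall>x\<in>M. norm (T x) \<le> b * norm x)}"


section \<open>Unbounded operators\<close>

text \<open>The values of \<open>app\<close> outside \<open>op_dom\<close> carry no meaning.\<close>

record 'a operator =
  op_dom :: "'a set"
  app :: "'a \<Rightarrow> 'a"

definition linear_op :: "'a::complex_inner operator \<Rightarrow> bool" where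
  "linear_op T \<longleftrightarrow> cvec.subspace (op_dom T)
     \<and> (\<forall>x\<in>op_dom T. \<forall>y\<in>op_dom T. app T (x + y) = app T x + app T y)
     \<and> (\<forall>c. \<forall>x\<in>op_dom T. app T (c *\<^sub>C x) = c *\<^sub>C app T x)"

definition closed_op :: "'a::complex_inner operator \<Rightarrow> bool" where
  "closed_op T \<longleftrightarrow> closed {(x, app T x) | x. x \<in> op_dom T}"

definition symmetric_op :: "'a::complex_inner operator \<Rightarrow> bool" where
  "symmetric_op T \<longleftrightarrow> (\<forall>f\<in>op_dom T. Im (cinner (app T f) f) = 0)"

definition ran_shift :: "'a::complex_inner operator \<Rightarrow> complex \<Rightarrow> 'a set" where
  "ran_shift T c = (\<lambda>f. app T f - c *\<^sub>C f) ` op_dom T"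


section \<open>Subspaces attached to a non-densely defined symmetric operator\<close>

definition H0 :: "'a::complex_inner operator \<Rightarrow> 'a set" where
  "H0 S = closure (op_dom S)"

definition Lspace :: "'a::complex_inner operator \<Rightarrow> 'a set" where
  "Lspace S = ominus UNIV (H0 S)"

definition S0 :: "'a::complex_inner operator \<Rightarrow> 'a operator" where
  "S0 S = \<lparr>op_dom = op_dom S, app = (\<lambda>f. proj (H0 S) (app S f))\<rparr>"

definition defect :: "'a::complex_inner operator \<Rightarrow> complex \<Rightarrow> 'a set" where
  "defect S \<mu> = ominus UNIV (ran_shift S (cnj \<mu>))"

definition Ldefect :: "'a::complex_inner operator \<Rightarrow> complex \<Rightarrow> 'a set" where
  "Ldefect S \<mu> = proj (defect S \<mu>) ` Lspace S"

definition semi_defect :: "'a::complex_inner operator \<Rightarrow> complex \<Rightarrow> 'a set" where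
  "semi_defect S \<mu> = ominus (defect S \<mu>) (Ldefect S \<mu>)"

text \<open>
  The dimension of \<open>semi_defect S \<mu>\<close> is constant on each of the two open half-planes,
  so it is evaluated at \<open>\<i>\<close> and \<open>-\<i>\<close>.
\<close>

definition semi_index_plus :: "'a::complex_inner operator \<Rightarrow> enat" where
  "semi_index_plus S = hdim (semi_defect S \<i>)"

definition semi_index_minus :: "'a::complex_inner operator \<Rightarrow> enat" where
  "semi_index_minus S = hdim (semi_defect S (- \<i>))"

definition V :: "'a::complex_inner operator \<Rightarrow> complex \<Rightarrow> 'a \<Rightarrow> 'a" where
  "V S \<mu> x = (THE y. \<exists>h\<in>Lspace S. x = proj (defect S \<mu>) h \<and> y = proj (defect S (cnj \<mu>)) h)"

definition regular :: "'a::complex_inner operator \<Rightarrow> bool" where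
  "regular S \<longleftrightarrow> closed_op (S0 S)"


section \<open>Shtraus extensions and characteristic functions\<close>

text \<open>
  The family \<open>M\<close> of deficiency subspaces is a parameter: it is \<open>defect S\<close> for \<open>S\<close> in the
  whole space, and \<open>semi_defect S\<close> for \<open>S0 S\<close> regarded as an operator in \<open>H0 S\<close>.
\<close>

definition shtraus ::
  "'a::complex_inner operator \<Rightarrow> (complex \<Rightarrow> 'a set) \<Rightarrow> complex \<Rightarrow> 'a operator" where
  "shtraus T M z =
     \<lparr>op_dom = {f + \<phi> | f \<phi>. f \<in> op_dom T \<and> \<phi> \<in> M z},
      app = (\<lambda>x. THE y. \<exists>f\<in>op_dom T. \<exists>\<phi>\<in>M z. x = f + \<phi> \<and> y = app T f + z *\<^sub>C \<phi>)\<rparr>"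

definition resolvent :: "'a::complex_inner operator \<Rightarrow> complex \<Rightarrow> 'a \<Rightarrow> 'a" where
  "resolvent T c = inv_into (op_dom T) (\<lambda>x. app T x - c *\<^sub>C x)"

definition char_fun ::
  "'a::complex_inner operator \<Rightarrow> (complex \<Rightarrow> 'a set) \<Rightarrow> complex \<Rightarrow> complex \<Rightarrow> 'a \<Rightarrow> 'a" where
  "char_fun T M \<mu> z = (\<lambda>\<phi>\<in>M \<mu>.
     let E = shtraus T M z; x = resolvent E (cnj \<mu>) \<phi> in app E x - \<mu> *\<^sub>C x)"

definition C_S :: "'a::complex_inner operator \<Rightarrow> complex \<Rightarrow> complex \<Rightarrow> 'a \<Rightarrow> 'a" where
  "C_S S = char_fun S (defect S)"

definition C_S0 :: "'a::complex_inner operator \<Rightarrow> complex \<Rightarrow> complex \<Rightarrow> 'a \<Rightarrow> 'a" where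
  "C_S0 S = char_fun (S0 S) (semi_defect S)"

definition A11 :: "'a::complex_inner operator \<Rightarrow> complex \<Rightarrow> complex \<Rightarrow> 'a \<Rightarrow> 'a" where
  "A11 S \<mu> z = (\<lambda>\<phi>\<in>Ldefect S \<mu>. proj (Ldefect S (cnj \<mu>)) (C_S S \<mu> z \<phi>))"

definition A12 :: "'a::complex_inner operator \<Rightarrow> complex \<Rightarrow> complex \<Rightarrow> 'a \<Rightarrow> 'a" where
  "A12 S \<mu> z = (\<lambda>\<phi>\<in>semi_defect S \<mu>. proj (Ldefect S (cnj \<mu>)) (C_S S \<mu> z \<phi>))"

definition A21 :: "'a::complex_inner operator \<Rightarrow> complex \<Rightarrow> complex \<Rightarrow> 'a \<Rightarrow> 'a" where
  "A21 S \<mu> z = (\<lambda>\<phi>\<in>Ldefect S \<mu>. proj (semi_defect S (cnj \<mu>)) (C_S S \<mu> z \<phi>))"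

definition A22 :: "'a::complex_inner operator \<Rightarrow> complex \<Rightarrow> complex \<Rightarrow> 'a \<Rightarrow> 'a" where
  "A22 S \<mu> z = (\<lambda>\<phi>\<in>semi_defect S \<mu>. proj (semi_defect S (cnj \<mu>)) (C_S S \<mu> z \<phi>))"

text \<open>
  The operator on the internal orthogonal sum of \<open>K\<close> and \<open>M\<close> with block matrix
  \<open>[[A, B], [C, D]]\<close>.  The first row takes values in the first summand of the target space
  and the second row in the second, so the entries of a column vector are added.
\<close>

definition block_op :: "'a::complex_inner set \<Rightarrow> 'a set \<Rightarrow>
    ('a \<Rightarrow> 'a) \<Rightarrow> ('a \<Rightarrow> 'a) \<Rightarrow> ('a \<Rightarrow> 'a) \<Rightarrow> ('a \<Rightarrow> 'a) \<Rightarrow> 'a \<Rightarrow> 'a" where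
  "block_op K M A B C D \<phi> =
     (A (proj K \<phi>) + B (proj M \<phi>)) + (C (proj K \<phi>) + D (proj M \<phi>))"

end

theory Submission
  imports Defs
begin

text \<open>
  For \<open>h\<close> in \<open>Lspace S\<close> write \<open>h = (S - cnj \<mu>) f + n\<close> with \<open>n\<close> in the defect space; then
  \<open>V n = n + (\<mu> - cnj \<mu>) f\<close>, which has the shape of the formula
  \<open>C \<phi> = \<phi> + (cnj \<mu> - \<mu>) x\<close>, \<open>(E - cnj \<mu>) x = \<phi>\<close>, for the characteristic function of the Shtraus
  extension \<open>E\<close>.  Hence \<open>(C - V) n = (cnj \<mu> - \<mu>) y\<close> with \<open>(E - cnj \<mu>) y = h\<close>, and inverting
  \<open>D = A11 - V\<close> means finding \<open>y\<close> with prescribed component in \<open>Lspace S\<close> and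
  \<open>(E - cnj \<mu>) y\<close> orthogonal to \<open>H0 S\<close>.  Uniqueness follows from dissipativity.  For existence the
  component is first lifted to \<open>defect S z\<close>, boundedly by regularity and the uniform boundedness
  principle, and then corrected by the resolvent of the Shtraus extension of \<open>S0 S\<close>.  For \<open>\<phi>\<close> in the
  semi-deficiency space and \<open>D n = A12 \<phi>\<close>, the vector \<open>w = x - y\<close> lies in \<open>H0 S\<close> and
  \<open>(E - cnj \<mu>) w = \<phi> - h\<close> has projection \<open>\<phi>\<close> there, so \<open>C \<phi> - (C - V) n\<close> is the value at \<open>\<phi>\<close> of
  the characteristic function of \<open>S0 S\<close>.
\<close>

section \<open>Orthogonal projections and uniform boundedness\<close>

lemma cinner_zero_left [simp]: "cinner 0 (x::'a::complex_inner) = 0"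
  using cinner_add_left[of 0 0 x] by simp

lemma cinner_zero_right [simp]: "cinner (x::'a::complex_inner) 0 = 0"
  by (metis cinner_commute cinner_zero_left complex_cnj_zero)

lemma cinner_add_right: "cinner (x::'a::complex_inner) (y + w) = cinner x y + cinner x w"
  by (metis cinner_commute cinner_add_left complex_cnj_add)

lemma cinner_scaleC_right: "cinner (x::'a::complex_inner) (c *\<^sub>C y) = cnj c * cinner x y"
  by (metis cinner_commute cinner_scaleC_left complex_cnj_mult)

lemma cinner_minus_left: "cinner (- (x::'a::complex_inner)) y = - cinner x y"
  using cinner_add_left[of x "- x" y] by (simp add: add_eq_0_iff)

lemma cinner_minus_right: "cinner (x::'a::complex_inner) (- y) = - cinner x y"
  using cinner_add_right[of x y "- y"] by (simp add: add_eq_0_iff)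

lemma cinner_diff_left: "cinner ((x::'a::complex_inner) - y) w = cinner x w - cinner y w"
  using cinner_add_left[of x "- y" w] by (simp add: cinner_minus_left)

lemma cinner_diff_right: "cinner (x::'a::complex_inner) (y - w) = cinner x y - cinner x w"
  using cinner_add_right[of x y "- w"] by (simp add: cinner_minus_right)

lemmas cinner_simps = cinner_add_left cinner_add_right cinner_diff_left cinner_diff_right
  cinner_scaleC_left cinner_scaleC_right cinner_minus_left cinner_minus_right

lemmas scaleC_simps = cvec.scale_right_distrib cvec.scale_left_distrib
  cvec.scale_right_diff_distrib cvec.scale_left_diff_distrib

lemma power2_norm_cinner: "(norm (x::'a::complex_inner))\<^sup>2 = Re (cinner x x)"
proof -
  \<comment> \<open>Positivity of the form comes from the norm: the real square root is odd, so a
    nonnegative \<open>sqrt\<close> has a nonnegative argument.\<close>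
  have "0 \<le> sqrt (Re (cinner x x))"
    using norm_ge_zero[of x] by (simp add: norm_eq_sqrt_cinner)
  then show ?thesis by (simp add: norm_eq_sqrt_cinner)
qed

lemma cinner_self: "cinner (x::'a::complex_inner) x = complex_of_real ((norm x)\<^sup>2)"
proof -
  have "Im (cinner x x) = 0"
    using arg_cong[OF cinner_commute[of x x], of Im] by simp
  then show ?thesis by (simp add: complex_eq_iff power2_norm_cinner)
qed

lemma cinner_self_eq_0 [simp]: "cinner (x::'a::complex_inner) x = 0 \<longleftrightarrow> x = 0"
  by (simp add: cinner_self)

lemma cinner_eq_0_commute: "cinner (x::'a::complex_inner) y = 0 \<longleftrightarrow> cinner y x = 0"
  by (metis cinner_commute complex_cnj_zero)

lemma norm_scaleC: "norm (c *\<^sub>C (x::'a::complex_inner)) = cmod c * norm x"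
proof -
  have "cinner (c *\<^sub>C x) (c *\<^sub>C x) = (c * cnj c) * cinner x x"
    by (simp add: cinner_simps)
  then have "complex_of_real ((norm (c *\<^sub>C x))\<^sup>2) = complex_of_real ((cmod c * norm x)\<^sup>2)"
    by (simp only: cinner_self complex_norm_square[symmetric] of_real_mult power_mult_distrib of_real_power)
  then have "(norm (c *\<^sub>C x))\<^sup>2 = (cmod c * norm x)\<^sup>2" by (simp only: of_real_eq_iff)
  then show ?thesis by (simp add: power2_eq_iff_nonneg)
qed

lemma norm_add_square:
  "(norm ((x::'a::complex_inner) + y))\<^sup>2 = (norm x)\<^sup>2 + (norm y)\<^sup>2 + 2 * Re (cinner x y)"
  using cinner_commute[of y x] by (simp add: power2_norm_cinner cinner_simps)

lemma norm_diff_square: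
  "(norm ((x::'a::complex_inner) - y))\<^sup>2 = (norm x)\<^sup>2 + (norm y)\<^sup>2 - 2 * Re (cinner x y)"
  using cinner_commute[of y x] by (simp add: power2_norm_cinner cinner_simps)

lemma norm_add_square_orth:
  "cinner (x::'a::complex_inner) y = 0 \<Longrightarrow> (norm (x + y))\<^sup>2 = (norm x)\<^sup>2 + (norm y)\<^sup>2"
  by (simp add: norm_add_square)

lemma cauchy_schwarz: "cmod (cinner (x::'a::complex_inner) y) \<le> norm x * norm y"
proof (cases "y = 0")
  case False
  \<comment> \<open>The coefficient of the projection of \<open>x\<close> onto the line spanned by
    \<open>y\<close>.\<close>
  define c where "c = cinner x y / complex_of_real ((norm y)\<^sup>2)"
  have "cinner (x - c *\<^sub>C y) (c *\<^sub>C y) = 0"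
    using False by (simp add: cinner_simps cinner_self[of y] c_def)
  from norm_add_square_orth[OF this] have "(norm (c *\<^sub>C y))\<^sup>2 \<le> (norm x)\<^sup>2" by simp
  then have "norm (c *\<^sub>C y) \<le> norm x" by (simp add: power2_le_iff_abs_le)
  then have "cmod (cinner x y) / norm y \<le> norm x"
    using False by (simp add: norm_scaleC c_def norm_divide norm_mult power2_eq_square)
  then show ?thesis using False by (simp add: divide_le_eq)
qed simp

lemma bounded_linear_cinner: "bounded_linear (\<lambda>x::'a::complex_inner. cinner x y)"
proof (rule bounded_linear_intro[where K = "norm y"])
  fix r and x :: 'a
  show "cinner (r *\<^sub>R x) y = r *\<^sub>R cinner x y"
    by (simp add: scaleR_scaleC cinner_simps scaleR_conv_of_real)
qed (simp_all add: cinner_simps cauchy_schwarz)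

lemma bounded_linear_scaleC: "bounded_linear (\<lambda>x::'a::complex_inner. c *\<^sub>C x)"
  by (rule bounded_linear_intro[where K = "cmod c"])
    (simp_all add: scaleC_simps norm_scaleC scaleR_scaleC mult.commute)

lemma closed_cinner_eq_0: "closed {x::'a::complex_inner. cinner x y = 0}"
  by (intro closed_Collect_eq continuous_intros
      linear_continuous_on[OF bounded_linear_cinner])

section \<open>Closed subspaces and the projection theorem\<close>

definition closed_csubspace :: "'a::complex_inner set \<Rightarrow> bool" where
  "closed_csubspace K \<longleftrightarrow> closed K \<and> cvec.subspace K"

lemma closed_csubspace_UNIV: "closed_csubspace UNIV"
  by (simp add: closed_csubspace_def)

lemma closed_csubspace_ominus:
  assumes "closed_csubspace K" shows "closed_csubspace (ominus K M)"
proof -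
  have "closed (K \<inter> (\<Inter>y\<in>M. {x. cinner x y = 0}))"
    using assms by (intro closed_Int closed_INT ballI closed_cinner_eq_0)
      (simp add: closed_csubspace_def)
  moreover have "K \<inter> (\<Inter>y\<in>M. {x. cinner x y = 0}) = ominus K M"
    by (auto simp: ominus_def)
  moreover have "cvec.subspace (ominus K M)"
    using assms
    by (auto simp: closed_csubspace_def cvec.subspace_def ominus_def cinner_simps)
  ultimately show ?thesis by (simp add: closed_csubspace_def)
qed

lemma ominusD: "x \<in> ominus K M \<Longrightarrow> y \<in> M \<Longrightarrow> cinner x y = 0"
  by (simp add: ominus_def)

lemma ominusD': "x \<in> ominus K M \<Longrightarrow> y \<in> M \<Longrightarrow> cinner y x = 0"
  by (simp add: ominus_def cinner_eq_0_commute[of y])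

lemma closure_csubspace:
  assumes "cvec.subspace (A :: 'a::complex_inner set)"
  shows "closed_csubspace (closure A)"
  unfolding closed_csubspace_def cvec.subspace_def
proof (intro conjI ballI allI)
  show "closed (closure A)" by simp
  show "0 \<in> closure A" using cvec.subspace_0[OF assms] closure_subset by blast
  fix x assume x: "x \<in> closure A"
  then obtain X where X: "\<And>n. X n \<in> A" "X \<longlonglongrightarrow> x" unfolding closure_sequential by blast
  show "c *\<^sub>C x \<in> closure A" for c
    unfolding closure_sequential using X
    by (intro exI[of _ "\<lambda>n. c *\<^sub>C X n"])
      (auto intro: bounded_linear.tendsto[OF bounded_linear_scaleC] cvec.subspace_scale[OF assms])
  fix y assume y: "y \<in> closure A"
  then obtain Y where Y: "\<And>n. Y n \<in> A" "Y \<longlonglongrightarrow> y" unfolding closure_sequential by blast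
  show "x + y \<in> closure A"
    unfolding closure_sequential using X Y
    by (intro exI[of _ "\<lambda>n. X n + Y n"])
      (auto intro: tendsto_add cvec.subspace_add[OF assms])
qed

lemma parallelogram:
  "(norm ((x::'a::complex_inner) + y))\<^sup>2 + (norm (x - y))\<^sup>2 = 2 * (norm x)\<^sup>2 + 2 * (norm y)\<^sup>2"
  by (simp add: norm_add_square norm_diff_square)

text \<open>The midpoint of two near-minimisers stays in \<open>K\<close>, so by the parallelogram
  law near-minimisers are close to each other; completeness supplies the limit.\<close>

lemma nearest_point_exists:
  fixes K :: "'a::complex_hilbert set"
  assumes K: "closed_csubspace K"
  shows "\<exists>y\<in>K. \<forall>k\<in>K. norm (x - y) \<le> norm (x - k)"
proof -
  have sub: "cvec.subspace K" and cl: "closed K" using K by (auto simp: closed_csubspace_def)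
  define D where "D = (\<lambda>k. (norm (x - k))\<^sup>2) ` K"
  define d where "d = Inf D"
  have ne: "D \<noteq> {}" using cvec.subspace_0[OF sub] by (auto simp: D_def)
  have bb: "bdd_below D" by (rule bdd_belowI[of _ 0]) (auto simp: D_def)
  have dle: "d \<le> (norm (x - k))\<^sup>2" if "k \<in> K" for k
    unfolding d_def by (rule cInf_lower[OF _ bb]) (use that in \<open>auto simp: D_def\<close>)
  have "\<exists>k\<in>K. (norm (x - k))\<^sup>2 < d + inverse (real (Suc n))" for n
  proof -
    have "Inf D < d + inverse (real (Suc n))" by (simp add: d_def)
    from cInf_lessD[OF ne this] show ?thesis by (auto simp: D_def)
  qed
  then obtain k where k: "\<And>n. k n \<in> K"
    "\<And>n. (norm (x - k n))\<^sup>2 < d + inverse (real (Suc n))" by metis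
  have dist_bound: "(dist (k m) (k n))\<^sup>2 \<le> 2 * inverse (real (Suc m)) + 2 * inverse (real (Suc n))" for m n
  proof -
    define q where "q = (1/2::complex) *\<^sub>C (k m + k n)"
    have "q \<in> K" unfolding q_def
      by (intro cvec.subspace_scale[OF sub] cvec.subspace_add[OF sub] k)
    then have "d \<le> (norm (x - q))\<^sup>2" by (rule dle)
    moreover have "(x - k m) + (x - k n) = 2 *\<^sub>C (x - q)"
      using cvec.scale_left_distrib[of 1 1 x]
      by (simp add: q_def scaleC_simps scaleC_one scaleC_scaleC)
    then have "(norm ((x - k m) + (x - k n)))\<^sup>2 = 4 * (norm (x - q))\<^sup>2"
      by (simp add: norm_scaleC power_mult_distrib)
    moreover have "norm ((x - k m) - (x - k n)) = dist (k m) (k n)"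
      by (simp add: dist_norm norm_minus_commute)
    ultimately show ?thesis
      using parallelogram[of "x - k m" "x - k n"] k(2)[of m] k(2)[of n] by simp
  qed
  have "Cauchy k"
  proof (rule metric_CauchyI)
    fix e :: real assume e: "0 < e"
    then obtain N where N: "inverse (real (Suc N)) < e\<^sup>2 / 4"
      using reals_Archimedean[of "e\<^sup>2 / 4"] by auto
    show "\<exists>M. \<forall>m\<ge>M. \<forall>n\<ge>M. dist (k m) (k n) < e"
    proof (intro exI allI impI)
      fix m n assume "N \<le> m" "N \<le> n"
      then have "inverse (real (Suc m)) \<le> inverse (real (Suc N))"
        "inverse (real (Suc n)) \<le> inverse (real (Suc N))"
        by (auto intro!: le_imp_inverse_le)
      then have "(dist (k m) (k n))\<^sup>2 < e\<^sup>2" using dist_bound[of m n] N by linarith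
      then show "dist (k m) (k n) < e" using e by (simp add: power2_less_imp_less)
    qed
  qed
  then obtain y where y: "k \<longlonglongrightarrow> y" using Cauchy_convergent_iff convergent_def by blast
  have "y \<in> K" using cl k(1) y closed_sequentially by blast
  moreover have "(norm (x - y))\<^sup>2 \<le> d"
  proof (rule LIMSEQ_le)
    show "(\<lambda>n. (norm (x - k n))\<^sup>2) \<longlonglongrightarrow> (norm (x - y))\<^sup>2" by (intro tendsto_intros y)
    show "(\<lambda>n. d + inverse (real (Suc n))) \<longlonglongrightarrow> d" by (rule LIMSEQ_inverse_real_of_nat_add)
    show "\<exists>N. \<forall>n\<ge>N. (norm (x - k n))\<^sup>2 \<le> d + inverse (real (Suc n))"
      using k(2) less_imp_le by blast
  qed
  ultimately show ?thesis
    using dle by (meson norm_ge_zero order_trans power2_le_imp_le)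
qed

lemma orthogonal_decomposition:
  fixes K :: "'a::complex_hilbert set"
  assumes K: "closed_csubspace K"
  shows "\<exists>y\<in>K. x - y \<in> ominus UNIV K"
proof -
  have sub: "cvec.subspace K" using K by (simp add: closed_csubspace_def)
  obtain y where y: "y \<in> K" "\<And>k. k \<in> K \<Longrightarrow> norm (x - y) \<le> norm (x - k)"
    using nearest_point_exists[OF K] by blast
  have "cinner (x - y) k = 0" if k: "k \<in> K" for k
  proof (cases "k = 0")
    case False
    \<comment> \<open>Moving \<open>y\<close> along \<open>k\<close> by this coefficient would
      shorten \<open>x - y\<close> by Pythagoras, so minimality forces \<open>c = 0\<close>.\<close>
    define c where "c = cinner (x - y) k / complex_of_real ((norm k)\<^sup>2)"
    have "y + c *\<^sub>C k \<in> K"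
      by (intro cvec.subspace_add[OF sub] cvec.subspace_scale[OF sub] y k)
    then have le: "norm (x - y) \<le> norm (x - y - c *\<^sub>C k)" using y(2) by (metis diff_diff_eq)
    have "cinner (x - y - c *\<^sub>C k) (c *\<^sub>C k) = 0"
      using False by (simp add: cinner_simps cinner_self[of k] c_def)
    from norm_add_square_orth[OF this]
    have "(norm (x - y))\<^sup>2 = (norm (x - y - c *\<^sub>C k))\<^sup>2 + (norm (c *\<^sub>C k))\<^sup>2" by simp
    moreover have "(norm (x - y))\<^sup>2 \<le> (norm (x - y - c *\<^sub>C k))\<^sup>2" using le by simp
    ultimately have "(norm (c *\<^sub>C k))\<^sup>2 \<le> 0" by linarith
    then have "c = 0" using False by simp
    then show ?thesis using False by (simp add: c_def)
  qed simp
  then show ?thesis using y(1) by (auto simp: ominus_def)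
qed

text \<open>Two candidates for the projection differ by a vector of \<open>K\<close> orthogonal to
  itself. Identities for \<open>proj\<close> thus reduce to a membership and an orthogonality
  check.\<close>

lemma proj_eqI:
  fixes K :: "'a::complex_inner set"
  assumes sub: "cvec.subspace K" and "y \<in> K" and "\<And>k. k \<in> K \<Longrightarrow> cinner (x - y) k = 0"
  shows "proj K x = y"
  unfolding proj_def
proof (rule the_equality)
  show "y \<in> K \<and> x - y \<in> ominus UNIV K" using assms by (simp add: ominus_def)
next
  fix w assume w: "w \<in> K \<and> x - w \<in> ominus UNIV K"
  have "w - y \<in> K" using w assms by (blast intro: cvec.subspace_diff)
  then have "cinner (x - y) (w - y) = 0" "cinner (x - w) (w - y) = 0"
    using w assms by (auto simp: ominus_def)
  then have "cinner ((x - y) - (x - w)) (w - y) = 0"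
    by (subst cinner_diff_left) simp
  then show "w = y" by simp
qed

text \<open>A locale, so that interpreting it for a deficiency subspace, a range or
  \<open>H0 S\<close> makes the projection calculus available there.\<close>

locale hilbert_subspace =
  fixes K :: "'a::complex_hilbert set"
  assumes closed_csubspace: "closed_csubspace K"
begin

lemma sub: "cvec.subspace K" and closed: "closed K"
  using closed_csubspace by (auto simp: closed_csubspace_def)

lemma complete: "complete K" using closed by (simp add: complete_eq_closed)

lemmas mem_add = cvec.subspace_add[OF sub] and mem_diff = cvec.subspace_diff[OF sub]
  and mem_scale = cvec.subspace_scale[OF sub] and mem_0 = cvec.subspace_0[OF sub]

lemmas proj_eqI = proj_eqI[OF sub]

lemma proj_mem: "proj K x \<in> K" and proj_orth: "x - proj K x \<in> ominus UNIV K"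
proof -
  obtain y where y: "y \<in> K" "x - y \<in> ominus UNIV K"
    using orthogonal_decomposition[OF closed_csubspace] by blast
  then have "proj K x = y" by (intro proj_eqI) (auto simp: ominus_def)
  then show "proj K x \<in> K" "x - proj K x \<in> ominus UNIV K" using y by auto
qed

lemma cinner_proj_left: "k \<in> K \<Longrightarrow> cinner (proj K x) k = cinner x k"
  using ominusD[OF proj_orth[of x], of k] by (simp add: cinner_diff_left)

lemma cinner_proj_right: "k \<in> K \<Longrightarrow> cinner k (proj K x) = cinner k x"
  using ominusD'[OF proj_orth[of x], of k] by (simp add: cinner_diff_right)

lemma proj_add: "proj K (x + y) = proj K x + proj K y"
  by (rule proj_eqI) (auto intro!: mem_add proj_mem simp: cinner_simps cinner_proj_left)

lemma proj_diff: "proj K (x - y) = proj K x - proj K y"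
  by (rule proj_eqI) (auto intro!: mem_diff proj_mem simp: cinner_simps cinner_proj_left)

lemma proj_scaleC: "proj K (c *\<^sub>C x) = c *\<^sub>C proj K x"
  by (rule proj_eqI) (auto intro!: mem_scale proj_mem simp: cinner_simps cinner_proj_left)

lemma proj_ident: "x \<in> K \<Longrightarrow> proj K x = x"
  by (rule proj_eqI) auto

lemma proj_eq_0: "(\<And>k. k \<in> K \<Longrightarrow> cinner x k = 0) \<Longrightarrow> proj K x = 0"
  by (rule proj_eqI) (auto simp: mem_0)

lemma norm_proj_le: "norm (proj K x) \<le> norm x"
proof -
  have "cinner (x - proj K x) (proj K x) = 0" using ominusD[OF proj_orth proj_mem] .
  from norm_add_square_orth[OF this] have "(norm (proj K x))\<^sup>2 \<le> (norm x)\<^sup>2" by simp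
  then show ?thesis by simp
qed

lemma ominus_ominus: "ominus UNIV (ominus UNIV K) = K"
proof
  show "K \<subseteq> ominus UNIV (ominus UNIV K)"
    by (auto simp: ominus_def cinner_eq_0_commute)
  show "ominus UNIV (ominus UNIV K) \<subseteq> K"
  proof
    fix x assume x: "x \<in> ominus UNIV (ominus UNIV K)"
    have "cinner x (x - proj K x) = 0" by (rule ominusD[OF x proj_orth])
    moreover have "cinner (proj K x) (x - proj K x) = 0"
      by (rule ominusD'[OF proj_orth proj_mem])
    ultimately have "cinner (x - proj K x) (x - proj K x) = 0"
      by (subst cinner_diff_left) simp
    then show "x \<in> K" using proj_mem[of x] by simp
  qed
qed

end

section \<open>Uniform boundedness of weakly bounded sets\<close>

text \<open>
  Sokal's argument: since \<open>2 (v, y) = (x + v, y) - (x - v, y)\<close>, one of the steps \<open>x \<plusminus> v\<close> makes the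
  functional large, and the steps are summable while the norms of the \<open>y n\<close> grow faster than the
  steps shrink.
\<close>
lemma weakly_bounded_imp_bounded:
  fixes B :: "'a::complex_hilbert set"
  assumes weak: "\<And>w. \<exists>b. \<forall>y\<in>B. cmod (cinner w y) \<le> b"
  shows "\<exists>b. \<forall>y\<in>B. norm y \<le> b"
proof (rule ccontr)
  assume "\<not> ?thesis"
  \<comment> \<open>Growth \<open>4 ^ n\<close> against steps of size \<open>(1/3)^n\<close> leaves
    functional values of order \<open>(4/3)^n\<close>.\<close>
  then have "\<exists>y\<in>B. 4 ^ n < norm y" for n :: nat by (meson not_le)
  then obtain y where y: "\<And>n. y n \<in> B" "\<And>n. 4 ^ n < norm (y n)" by metis
  have pos: "0 < norm (y n)" for n using y(2)[of n] by (smt (verit) zero_less_power)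
  have step: "\<exists>x'. norm (x' - x) \<le> (1/3)^n \<and> (1/3)^n * norm (y n) \<le> cmod (cinner x' (y n))" for x n
  proof -
    define v where "v = complex_of_real ((1/3)^n / norm (y n)) *\<^sub>C y n"
    have nv: "norm v = (1/3)^n" using pos[of n]
      by (simp add: v_def norm_scaleC norm_divide norm_power)
    have cv: "cinner v (y n) = complex_of_real ((1/3)^n * norm (y n))"
      using pos[of n] by (simp add: v_def cinner_simps cinner_self power2_eq_square)
    have "2 * cinner v (y n) = cinner (x + v) (y n) - cinner (x - v) (y n)"
      by (simp add: cinner_simps)
    then have "2 * ((1/3)^n * norm (y n)) = cmod (cinner (x + v) (y n) - cinner (x - v) (y n))"
      unfolding cv by (metis (no_types, lifting) abs_of_nonneg norm_mult norm_numeral norm_of_real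
          mult_nonneg_nonneg norm_ge_zero zero_le_power divide_nonneg_nonneg zero_le_one zero_le_numeral)
    also have "\<dots> \<le> cmod (cinner (x + v) (y n)) + cmod (cinner (x - v) (y n))"
      by (rule norm_triangle_ineq4)
    finally have "(1/3)^n * norm (y n) \<le> cmod (cinner (x + v) (y n))
        \<or> (1/3)^n * norm (y n) \<le> cmod (cinner (x - v) (y n))" by linarith
    then show ?thesis
    proof
      assume "(1/3)^n * norm (y n) \<le> cmod (cinner (x + v) (y n))"
      then show ?thesis using nv by (intro exI[of _ "x + v"]) simp
    next
      assume "(1/3)^n * norm (y n) \<le> cmod (cinner (x - v) (y n))"
      then show ?thesis using nv by (intro exI[of _ "x - v"]) simp
    qed
  qed
  then obtain g where g: "\<And>x n. norm (g x n - x) \<le> (1/3)^n"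
    "\<And>x n. (1/3)^n * norm (y n) \<le> cmod (cinner (g x n) (y n))" by metis
  define X where "X = rec_nat 0 (\<lambda>n x. g x n)"
  have X: "X (Suc n) = g (X n) n" for n by (simp add: X_def)
  have inc: "norm (X (Suc n) - X n) \<le> (1/3)^n" for n using g(1) by (simp add: X)
  \<comment> \<open>The right side is the geometric sum of \<open>(1/3)^j\<close> over
    \<open>n < j \<le> n + k\<close>.\<close>
  have far: "dist (X (Suc n)) (X (Suc n + k)) \<le> (1/3)^n / 2 - (1/3)^(n + k) / 2" for n k
  proof (induction k)
    case (Suc k)
    have "dist (X (Suc n)) (X (Suc n + Suc k))
        \<le> dist (X (Suc n)) (X (Suc n + k)) + dist (X (Suc n + k)) (X (Suc (Suc n + k)))"
      using dist_triangle by (metis add_Suc_right)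
    moreover have "dist (X (Suc n + k)) (X (Suc (Suc n + k))) \<le> (1/3)^(n + k) / 3"
      using inc[of "Suc n + k"] by (simp add: dist_norm norm_minus_commute)
    ultimately show ?case using Suc by simp
  qed simp
  have far': "dist (X (Suc n)) (X m) \<le> (1/3)^n / 2" if "Suc n \<le> m" for n m
  proof -
    have "dist (X (Suc n)) (X m) \<le> (1/3)^n / 2 - (1/3)^(n + (m - Suc n)) / 2"
      using far[of n "m - Suc n"] that by simp
    also have "\<dots> \<le> (1/3)^n / 2" by simp
    finally show ?thesis .
  qed
  have "Cauchy X"
  proof (rule metric_CauchyI)
    fix e :: real assume "0 < e"
    then obtain N where N: "(1/3::real)^N < e" using real_arch_pow_inv[of e "1/3"] by auto
    show "\<exists>M. \<forall>m\<ge>M. \<forall>n\<ge>M. dist (X m) (X n) < e"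
    proof (intro exI allI impI)
      fix m n assume "Suc N \<le> m" "Suc N \<le> n"
      then show "dist (X m) (X n) < e"
        using far'[of N m] far'[of N n] N dist_triangle3[of "X m" "X n" "X (Suc N)"] by linarith
    qed
  qed
  then obtain x where x: "X \<longlonglongrightarrow> x" using Cauchy_convergent_iff convergent_def by blast
  have lim: "norm (X (Suc n) - x) \<le> (1/3)^n / 2" for n
  proof (rule LIMSEQ_le_const2)
    show "(\<lambda>m. norm (X (Suc n) - X m)) \<longlonglongrightarrow> norm (X (Suc n) - x)" by (intro tendsto_intros x)
    show "\<exists>N. \<forall>m\<ge>N. norm (X (Suc n) - X m) \<le> (1/3)^n / 2"
      using far'[of n] by (auto simp: dist_norm)
  qed
  have low: "(4/3)^n / 2 \<le> cmod (cinner x (y n))" for n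
  proof -
    have "cmod (cinner (X (Suc n) - x) (y n)) \<le> norm (X (Suc n) - x) * norm (y n)"
      by (rule cauchy_schwarz)
    also have "\<dots> \<le> (1/3)^n / 2 * norm (y n)" by (rule mult_right_mono[OF lim]) simp
    finally have a: "cmod (cinner (X (Suc n)) (y n) - cinner x (y n)) \<le> (1/3)^n / 2 * norm (y n)"
      by (simp add: cinner_simps)
    have "(1/3)^n * norm (y n) \<le> cmod (cinner (X (Suc n)) (y n))" using g(2) by (simp add: X)
    \<comment> \<open>The steps after stage \<open>Suc n\<close> cost at most half of the value
      reached there.\<close>
    then have "(1/3)^n * norm (y n) / 2 \<le> cmod (cinner x (y n))"
      using a norm_triangle_ineq2[of "cinner (X (Suc n)) (y n)" "cinner x (y n)"] by simp
    moreover have "(4/3::real)^n = (1/3)^n * 4^n" by (simp add: power_mult_distrib[symmetric])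
    moreover have "(1/3::real)^n * 4^n \<le> (1/3)^n * norm (y n)"
      by (rule mult_left_mono) (use y(2)[of n] in auto)
    ultimately show ?thesis by linarith
  qed
  obtain b where b: "\<And>v. v \<in> B \<Longrightarrow> cmod (cinner x v) \<le> b" using weak by blast
  obtain n where "2 * b < (4/3::real)^n" using real_arch_pow[of "4/3"] by auto
  then show False using low[of n] b[OF y(1)[of n]] by simp
qed


section \<open>Closed symmetric operators and Shtraus extensions\<close>

lemma linear_op_D:
  assumes "linear_op T"
  shows "cvec.subspace (op_dom T)"
    and "\<And>x y. x \<in> op_dom T \<Longrightarrow> y \<in> op_dom T \<Longrightarrow> app T (x + y) = app T x + app T y"
    and "\<And>c x. x \<in> op_dom T \<Longrightarrow> app T (c *\<^sub>C x) = c *\<^sub>C app T x"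
    and "0 \<in> op_dom T"
    and "\<And>x y. x \<in> op_dom T \<Longrightarrow> y \<in> op_dom T \<Longrightarrow> x + y \<in> op_dom T"
    and "\<And>x y. x \<in> op_dom T \<Longrightarrow> y \<in> op_dom T \<Longrightarrow> x - y \<in> op_dom T"
    and "\<And>c x. x \<in> op_dom T \<Longrightarrow> c *\<^sub>C x \<in> op_dom T"
  using assms unfolding linear_op_def
  by (auto intro: cvec.subspace_0 cvec.subspace_add cvec.subspace_diff cvec.subspace_scale)

lemma linear_op_diff:
  assumes "linear_op T" "x \<in> op_dom T" "y \<in> op_dom T"
  shows "app T (x - y) = app T x - app T y"
  using linear_op_D(2)[OF assms(1), of "x - y" y] linear_op_D(6)[OF assms] assms by simp

lemma linear_op_zero:
  assumes "linear_op T" shows "app T 0 = 0"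
  using linear_op_D(2)[OF assms linear_op_D(4)[OF assms] linear_op_D(4)[OF assms]] by simp

text \<open>The ambient space \<open>K\<close> is a parameter because the theory is applied twice:
  to \<open>S\<close> in the whole space and to \<open>S0 S\<close> in \<open>H0 S\<close>.\<close>

locale symmetric_operator = hilbert_subspace K for K :: "'a::complex_hilbert set" +
  fixes T :: "'a operator"
  assumes lin: "linear_op T" and closed_T: "closed_op T" and symm: "symmetric_op T"
    and dom: "op_dom T \<subseteq> K" and app_mem: "\<And>f. f \<in> op_dom T \<Longrightarrow> app T f \<in> K"
begin

definition M :: "complex \<Rightarrow> 'a set" where
  "M c = ominus K (ran_shift T (cnj c))"

lemmas T_dom = linear_op_D(4-7)[OF lin]
lemmas T_lin = linear_op_D(2,3)[OF lin] linear_op_diff[OF lin] linear_op_zero[OF lin]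

lemma M_subspace: "hilbert_subspace (M c)"
  unfolding M_def by unfold_locales (rule closed_csubspace_ominus[OF closed_csubspace])

lemma M_mem: "\<phi> \<in> M c \<Longrightarrow> \<phi> \<in> K"
  by (simp add: M_def ominus_def)

lemma cinner_app_self: "f \<in> op_dom T \<Longrightarrow> Im (cinner (app T f) f) = 0"
  using symm by (simp add: symmetric_op_def)

text \<open>Polarization: reality of the form at \<open>f + g\<close> settles the imaginary part of
  the identity, reality at \<open>f + \<i> *\<^sub>C g\<close> the real part.\<close>

lemma app_symmetric:
  assumes f: "f \<in> op_dom T" and g: "g \<in> op_dom T"
  shows "cinner (app T f) g = cinner f (app T g)"
proof -
  have a: "Im (cinner (app T (f + g)) (f + g)) = 0"
    by (intro cinner_app_self T_dom f g)
  have b: "Im (cinner (app T (f + \<i> *\<^sub>C g)) (f + \<i> *\<^sub>C g)) = 0"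
    by (intro cinner_app_self T_dom f g)
  have c: "cinner f (app T g) = cnj (cinner (app T g) f)" by (rule cinner_commute)
  show ?thesis
    using a b cinner_app_self[OF f] cinner_app_self[OF g]
    unfolding c by (simp add: T_lin f g T_dom cinner_simps complex_eq_iff)
qed

text \<open>The form of \<open>T - Re c\<close> is real, so its cross term with the imaginary part
  of the shift vanishes.\<close>

lemma shift_norm:
  assumes f: "f \<in> op_dom T"
  shows "(norm (app T f - c *\<^sub>C f))\<^sup>2 = (norm (app T f - complex_of_real (Re c) *\<^sub>C f))\<^sup>2 + (Im c)\<^sup>2 * (norm f)\<^sup>2"
proof -
  define u where "u = app T f - complex_of_real (Re c) *\<^sub>C f"
  have "Im (cinner u f) = 0"
    using cinner_app_self[OF f] by (simp add: u_def cinner_simps cinner_self)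
  moreover have eq: "app T f - c *\<^sub>C f = u - (\<i> * complex_of_real (Im c)) *\<^sub>C f"
    unfolding u_def by (subst complex_eq[of c]) (simp add: scaleC_simps)
  ultimately show ?thesis
    unfolding eq u_def[symmetric]
    by (simp add: norm_diff_square norm_scaleC norm_mult cinner_simps power_mult_distrib)
qed

text \<open>Only the square of \<open>Im c\<close> enters \<open>shift_norm\<close>; this is the
  isometry behind the Cayley transform.\<close>

lemma shift_norm_cnj:
  "f \<in> op_dom T \<Longrightarrow> norm (app T f - cnj c *\<^sub>C f) = norm (app T f - c *\<^sub>C f)"
  using shift_norm[of f c] shift_norm[of f "cnj c"] by (simp add: power2_eq_imp_eq)

lemma shift_lower:
  assumes "f \<in> op_dom T" shows "\<bar>Im c\<bar> * norm f \<le> norm (app T f - c *\<^sub>C f)"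
proof -
  have "(\<bar>Im c\<bar> * norm f)\<^sup>2 \<le> (norm (app T f - c *\<^sub>C f))\<^sup>2"
    using shift_norm[OF assms, of c] by (simp add: power_mult_distrib)
  then show ?thesis by (rule power2_le_imp_le) simp
qed

lemma shift_diff:
  assumes "f \<in> op_dom T" "g \<in> op_dom T"
  shows "app T (f - g) - c *\<^sub>C (f - g) = (app T f - c *\<^sub>C f) - (app T g - c *\<^sub>C g)"
  by (simp add: T_lin assms scaleC_simps)

text \<open>By \<open>shift_lower\<close> the preimages of a convergent sequence are Cauchy, and the
  closed graph identifies the limit.\<close>

lemma closed_csubspace_ran_shift:
  assumes c: "Im c \<noteq> 0" shows "closed_csubspace (ran_shift T c)"
  unfolding closed_csubspace_def
proof
  show "cvec.subspace (ran_shift T c)"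
    unfolding cvec.subspace_def ran_shift_def
  proof (intro conjI ballI allI)
    show "0 \<in> (\<lambda>f. app T f - c *\<^sub>C f) ` op_dom T"
      by (rule image_eqI[where x = 0]) (simp_all add: T_lin T_dom)
    fix x assume "x \<in> (\<lambda>f. app T f - c *\<^sub>C f) ` op_dom T"
    then obtain f where f: "f \<in> op_dom T" "x = app T f - c *\<^sub>C f" by blast
    show "d *\<^sub>C x \<in> (\<lambda>f. app T f - c *\<^sub>C f) ` op_dom T" for d
      by (rule image_eqI[where x = "d *\<^sub>C f"])
        (simp_all add: T_lin T_dom f scaleC_simps scaleC_scaleC mult.commute)
    fix y assume "y \<in> (\<lambda>f. app T f - c *\<^sub>C f) ` op_dom T"
    then obtain g where g: "g \<in> op_dom T" "y = app T g - c *\<^sub>C g" by blast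
    show "x + y \<in> (\<lambda>f. app T f - c *\<^sub>C f) ` op_dom T"
      by (rule image_eqI[where x = "f + g"]) (simp_all add: T_lin T_dom f g scaleC_simps)
  qed
  show "closed (ran_shift T c)"
    unfolding closed_sequential_limits
  proof (intro allI impI, elim conjE)
    fix X l assume "\<forall>n. X n \<in> ran_shift T c" and X: "X \<longlonglongrightarrow> l"
    then have "\<forall>n. \<exists>f. f \<in> op_dom T \<and> X n = app T f - c *\<^sub>C f" unfolding ran_shift_def by blast
    then obtain f where f: "\<And>n. f n \<in> op_dom T" "\<And>n. X n = app T (f n) - c *\<^sub>C f n" by metis
    have "Cauchy f"
    proof (rule metric_CauchyI)
      fix e :: real assume "0 < e"
      then have "0 < \<bar>Im c\<bar> * e" using c by simp
      then obtain N where N: "\<And>m n. m \<ge> N \<Longrightarrow> n \<ge> N \<Longrightarrow> dist (X m) (X n) < \<bar>Im c\<bar> * e"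
        using metric_CauchyD[OF LIMSEQ_imp_Cauchy[OF X]] by blast
      show "\<exists>N. \<forall>m\<ge>N. \<forall>n\<ge>N. dist (f m) (f n) < e"
      proof (intro exI allI impI)
        fix m n assume "N \<le> m" "N \<le> n"
        moreover have "\<bar>Im c\<bar> * norm (f m - f n) \<le> norm (X m - X n)"
          using shift_lower[of "f m - f n" c] by (simp add: f T_dom shift_diff)
        ultimately have "\<bar>Im c\<bar> * dist (f m) (f n) < \<bar>Im c\<bar> * e"
          using N[of m n] by (simp add: dist_norm)
        then show "dist (f m) (f n) < e" using c by simp
      qed
    qed
    then obtain g where g: "f \<longlonglongrightarrow> g" using Cauchy_convergent_iff convergent_def by blast
    have "(\<lambda>n. X n + c *\<^sub>C f n) \<longlonglongrightarrow> l + c *\<^sub>C g"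
      by (intro tendsto_add X bounded_linear.tendsto[OF bounded_linear_scaleC] g)
    then have "(\<lambda>n. app T (f n)) \<longlonglongrightarrow> l + c *\<^sub>C g" by (simp add: f)
    with g have "(\<lambda>n. (f n, app T (f n))) \<longlonglongrightarrow> (g, l + c *\<^sub>C g)" by (rule tendsto_Pair)
    moreover have "(f n, app T (f n)) \<in> {(x, app T x) | x. x \<in> op_dom T}" for n
      using f(1) by blast
    ultimately have "(g, l + c *\<^sub>C g) \<in> {(x, app T x) | x. x \<in> op_dom T}"
      using closed_sequentially[OF closed_T[unfolded closed_op_def]] by meson
    then have "g \<in> op_dom T" "l = app T g - c *\<^sub>C g" by (auto simp: algebra_simps)
    then show "l \<in> ran_shift T c" unfolding ran_shift_def by blast
  qed
qed

lemma defect_decomposition: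
  assumes c: "Im c \<noteq> 0" and k: "k \<in> K"
  shows "\<exists>f\<in>op_dom T. \<exists>\<phi>\<in>M c. k = app T f - cnj c *\<^sub>C f + \<phi>"
proof -
  interpret R: hilbert_subspace "ran_shift T (cnj c)"
    using closed_csubspace_ran_shift[of "cnj c"] c by unfold_locales simp
  obtain f where f: "f \<in> op_dom T" "proj (ran_shift T (cnj c)) k = app T f - cnj c *\<^sub>C f"
    using R.proj_mem[of k] by (auto simp: ran_shift_def)
  have "k - (app T f - cnj c *\<^sub>C f) \<in> K"
    using f(1) k dom by (intro mem_diff mem_scale app_mem) auto
  then have "k - (app T f - cnj c *\<^sub>C f) \<in> M c"
    using R.proj_orth[of k] f(2) by (simp add: M_def ominus_def)
  then show ?thesis using f(1) by (intro bexI) auto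
qed

text \<open>Weak form of saying that \<open>\<phi>\<close> is an eigenvector of the adjoint for
  \<open>c\<close>; a domain that is not dense determines no adjoint operator.\<close>

lemma cinner_defect: 
  assumes "\<phi> \<in> M c" "f \<in> op_dom T"
  shows "cinner \<phi> (app T f) = c * cinner \<phi> f" and "cinner (app T f) \<phi> = cnj c * cinner f \<phi>"
    and "cinner \<phi> (app T f - cnj c *\<^sub>C f) = 0" and "cinner (app T f - cnj c *\<^sub>C f) \<phi> = 0"
proof -
  show a: "cinner \<phi> (app T f - cnj c *\<^sub>C f) = 0"
    using assms by (auto simp: M_def ominus_def ran_shift_def)
  then show b: "cinner \<phi> (app T f) = c * cinner \<phi> f" by (simp add: cinner_simps)
  show "cinner (app T f - cnj c *\<^sub>C f) \<phi> = 0" using a by (simp add: cinner_eq_0_commute)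
  show "cinner (app T f) \<phi> = cnj c * cinner f \<phi>"
    using arg_cong[OF b, of cnj] by (simp add: cinner_commute[symmetric])
qed

text \<open>For a common vector, \<open>c\<close> times its squared norm would be real. This makes
  the sum in the domain of the Shtraus extension direct.\<close>

lemma dom_Int_defect:
  assumes "Im c \<noteq> 0" "f \<in> op_dom T" "f \<in> M c" shows "f = 0"
proof -
  have "Im (c * cinner f f) = 0"
    using cinner_defect(1)[OF assms(3,2)] app_symmetric[OF assms(2,2)] cinner_app_self[OF assms(2)] by simp
  then show ?thesis using assms(1) by (simp add: cinner_self)
qed

end

section \<open>Dissipativity and surjectivity of Shtraus extensions\<close>

locale shtraus_extension = symmetric_operator +
  fixes z :: complex
  assumes z: "Im z > 0"
begin

abbreviation E where "E \<equiv> shtraus T M z"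

lemma dom_E: "op_dom E = {f + \<phi> | f \<phi>. f \<in> op_dom T \<and> \<phi> \<in> M z}"
  by (simp add: shtraus_def)

lemma dom_EI: "f \<in> op_dom T \<Longrightarrow> \<phi> \<in> M z \<Longrightarrow> f + \<phi> \<in> op_dom E"
  by (auto simp: dom_E)

text \<open>Directness of the sum makes the definite description single-valued.\<close>

lemma app_E:
  assumes f: "f \<in> op_dom T" and \<phi>: "\<phi> \<in> M z"
  shows "app E (f + \<phi>) = app T f + z *\<^sub>C \<phi>"
proof -
  interpret Mz: hilbert_subspace "M z" by (rule M_subspace)
  have "(THE y. \<exists>g\<in>op_dom T. \<exists>\<psi>\<in>M z. f + \<phi> = g + \<psi> \<and> y = app T g + z *\<^sub>C \<psi>) = app T f + z *\<^sub>C \<phi>"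
  proof (rule the_equality)
    show "\<exists>g\<in>op_dom T. \<exists>\<psi>\<in>M z. f + \<phi> = g + \<psi> \<and> app T f + z *\<^sub>C \<phi> = app T g + z *\<^sub>C \<psi>"
      using assms by blast
    fix y assume "\<exists>g\<in>op_dom T. \<exists>\<psi>\<in>M z. f + \<phi> = g + \<psi> \<and> y = app T g + z *\<^sub>C \<psi>"
    then obtain g \<psi> where g: "g \<in> op_dom T" "\<psi> \<in> M z" "f + \<phi> = g + \<psi>" "y = app T g + z *\<^sub>C \<psi>"
      by blast
    have eq: "f - g = \<psi> - \<phi>" using g(3) by (simp add: algebra_simps)
    have "f - g = 0"
      by (rule dom_Int_defect[of z]) (use z f g in \<open>auto simp: T_dom eq[symmetric]\<close>,
        simp add: eq Mz.mem_diff \<phi> g)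
    then show "y = app T f + z *\<^sub>C \<phi>" using g eq by simp
  qed
  then show ?thesis by (simp add: shtraus_def)
qed

lemma linear_E: "linear_op E"
proof -
  interpret Mz: hilbert_subspace "M z" by (rule M_subspace)
  have add: "x + y \<in> op_dom E \<and> app E (x + y) = app E x + app E y"
    if xy: "x \<in> op_dom E" "y \<in> op_dom E" for x y
  proof -
    obtain f \<phi> where f: "f \<in> op_dom T" "\<phi> \<in> M z" "x = f + \<phi>" using xy by (auto simp: dom_E)
    obtain g \<psi> where g: "g \<in> op_dom T" "\<psi> \<in> M z" "y = g + \<psi>" using xy by (auto simp: dom_E)
    have eq: "x + y = (f + g) + (\<phi> + \<psi>)" by (simp add: f g)
    have mem: "f + g \<in> op_dom T" "\<phi> + \<psi> \<in> M z" by (auto simp: f g T_dom Mz.mem_add)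
    show ?thesis unfolding eq using dom_EI[OF mem] app_E[OF mem]
      by (simp add: f g app_E T_lin scaleC_simps)
  qed
  have scale: "c *\<^sub>C x \<in> op_dom E \<and> app E (c *\<^sub>C x) = c *\<^sub>C app E x"
    if x: "x \<in> op_dom E" for c x
  proof -
    obtain f \<phi> where f: "f \<in> op_dom T" "\<phi> \<in> M z" "x = f + \<phi>" using x by (auto simp: dom_E)
    have eq: "c *\<^sub>C x = c *\<^sub>C f + c *\<^sub>C \<phi>" by (simp add: f scaleC_simps)
    have mem: "c *\<^sub>C f \<in> op_dom T" "c *\<^sub>C \<phi> \<in> M z" by (auto simp: f T_dom Mz.mem_scale)
    show ?thesis unfolding eq using dom_EI[OF mem] app_E[OF mem]
      by (simp add: f app_E T_lin scaleC_simps scaleC_scaleC mult.commute)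
  qed
  have "0 \<in> op_dom E" using dom_EI[OF T_dom(1) Mz.mem_0] by simp
  then show ?thesis using add scale by (auto simp: linear_op_def cvec.subspace_def)
qed

lemmas E_dom = linear_op_D(4-7)[OF linear_E]
lemmas E_lin = linear_op_D(2,3)[OF linear_E] linear_op_diff[OF linear_E] linear_op_zero[OF linear_E]

lemma dom_E_mem: "x \<in> op_dom E \<Longrightarrow> x \<in> K"
  using dom by (auto simp: dom_E intro!: mem_add dest: M_mem)

lemma app_E_mem: "x \<in> op_dom E \<Longrightarrow> app E x \<in> K"
  by (auto simp: dom_E app_E intro!: mem_add mem_scale app_mem dest: M_mem)

text \<open>The cross terms are conjugate to each other and the form of \<open>T\<close> is real, so
  only \<open>z * cinner \<phi> \<phi>\<close> has an imaginary part.\<close>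

lemma E_dissipative_eq:
  assumes f: "f \<in> op_dom T" and \<phi>: "\<phi> \<in> M z"
  shows "Im (cinner (app E (f + \<phi>)) (f + \<phi>)) = Im z * (norm \<phi>)\<^sup>2"
proof -
  have "cinner (app E (f + \<phi>)) (f + \<phi>)
      = cinner (app T f) f + (cnj z * cinner f \<phi> + z * cinner \<phi> f) + z * cinner \<phi> \<phi>"
    using cinner_defect(2)[OF \<phi> f] by (simp add: app_E[OF f \<phi>] cinner_simps distrib_left)
  moreover have "cnj z * cinner f \<phi> = cnj (z * cinner \<phi> f)"
    by (simp add: cinner_commute[symmetric])
  ultimately show ?thesis using cinner_app_self[OF f] by (simp add: cinner_self)
qed

lemma E_dissipative: "x \<in> op_dom E \<Longrightarrow> Im (cinner (app E x) x) \<ge> 0"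
  using z by (auto simp: dom_E E_dissipative_eq)

lemma E_shift_Im:
  "Im (cinner (app E x - cnj c *\<^sub>C x) x) = Im (cinner (app E x) x) + Im c * (norm x)\<^sup>2"
  by (simp add: cinner_simps cinner_self)

lemma E_shift_lower:
  assumes x: "x \<in> op_dom E" and c: "Im c > 0"
  shows "Im c * norm x \<le> norm (app E x - cnj c *\<^sub>C x)"
proof (cases "x = 0")
  case False
  have "Im c * (norm x)\<^sup>2 \<le> Im (cinner (app E x - cnj c *\<^sub>C x) x)"
    using E_dissipative[OF x] by (simp add: E_shift_Im)
  also have "\<dots> \<le> norm (app E x - cnj c *\<^sub>C x) * norm x"
    using abs_Im_le_cmod cauchy_schwarz by (meson abs_le_D1 order_trans)
  finally have "Im c * norm x * norm x \<le> norm (app E x - cnj c *\<^sub>C x) * norm x"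
    by (simp add: power2_eq_square mult.assoc)
  then show ?thesis using False by simp
qed simp

text \<open>Dissipation controls the component in \<open>M z\<close> on its own: \<open>Im z\<close>
  times its squared norm is at most \<open>norm u * norm (f + \<phi>)\<close>, and
  \<open>E_shift_lower\<close> bounds the last factor. The bound on the inverse of the corner rests
  on this.\<close>

lemma E_component_bound:
  assumes f: "f \<in> op_dom T" and \<phi>: "\<phi> \<in> M z" and c: "Im c > 0"
    and u: "app E (f + \<phi>) - cnj c *\<^sub>C (f + \<phi>) = u"
  shows "norm \<phi> \<le> norm u / sqrt (Im z * Im c)"
proof -
  have x: "f + \<phi> \<in> op_dom E" using f \<phi> by (rule dom_EI)
  have "Im z * (norm \<phi>)\<^sup>2 \<le> Im (cinner u (f + \<phi>))"
    using E_shift_Im[of "f + \<phi>" c] c by (simp add: u E_dissipative_eq[OF f \<phi>])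
  also have "\<dots> \<le> norm u * norm (f + \<phi>)"
    using abs_Im_le_cmod cauchy_schwarz by (meson abs_le_D1 order_trans)
  finally have "Im c * (Im z * (norm \<phi>)\<^sup>2) \<le> Im c * (norm u * norm (f + \<phi>))"
    using c by (intro mult_left_mono) auto
  also have "\<dots> = norm u * (Im c * norm (f + \<phi>))" by simp
  also have "\<dots> \<le> norm u * norm u"
    using E_shift_lower[OF x c] by (intro mult_left_mono) (auto simp: u)
  finally have "(norm \<phi>)\<^sup>2 * (Im z * Im c) \<le> (norm u)\<^sup>2"
    by (simp add: power2_eq_square mult_ac)
  then have "(norm \<phi>)\<^sup>2 \<le> (norm u)\<^sup>2 / (Im z * Im c)"
    using z c by (simp add: pos_le_divide_eq)
  from real_sqrt_le_mono[OF this] show ?thesis by (simp add: real_sqrt_divide)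
qed

lemma E_shift_inj:
  assumes "x \<in> op_dom E" "y \<in> op_dom E" "Im c > 0"
    "app E x - cnj c *\<^sub>C x = app E y - cnj c *\<^sub>C y"
  shows "x = y"
proof -
  have "app E (x - y) - cnj c *\<^sub>C (x - y) = 0"
    using assms by (simp add: E_lin scaleC_simps algebra_simps)
  then have "Im c * norm (x - y) \<le> 0"
    using E_shift_lower[of "x - y" c] assms E_dom by auto
  then show ?thesis using assms(3) by (simp add: mult_le_0_iff)
qed

text \<open>On \<open>f + \<psi>\<close> the operator \<open>E - cnj z\<close> gives
  \<open>(T - cnj z) f + (z - cnj z) \<psi>\<close>, so the orthogonal splitting of \<open>K\<close>
  solves the equation at this point.\<close>

lemma E_surj_at_z: "k \<in> K \<Longrightarrow> \<exists>x\<in>op_dom E. app E x - cnj z *\<^sub>C x = k"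
proof -
  assume "k \<in> K"
  interpret Mz: hilbert_subspace "M z" by (rule M_subspace)
  have zz: "z - cnj z \<noteq> 0" using z by (simp add: complex_eq_iff)
  obtain f \<phi> where f: "f \<in> op_dom T" "\<phi> \<in> M z" "k = app T f - cnj z *\<^sub>C f + \<phi>"
    using defect_decomposition[of z k] z \<open>k \<in> K\<close> by auto
  define \<psi> where "\<psi> = inverse (z - cnj z) *\<^sub>C \<phi>"
  have \<psi>: "\<psi> \<in> M z" by (simp add: \<psi>_def f Mz.mem_scale)
  have "app E (f + \<psi>) - cnj z *\<^sub>C (f + \<psi>) = app T f - cnj z *\<^sub>C f + (z - cnj z) *\<^sub>C \<psi>"
    by (simp add: app_E f \<psi> scaleC_simps)
  also have "(z - cnj z) *\<^sub>C \<psi> = \<phi>" using zz by (simp add: \<psi>_def scaleC_scaleC scaleC_one)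
  finally show ?thesis using f dom_EI[OF f(1) \<psi>] by auto
qed

text \<open>\<open>E - z\<close> annihilates the component in \<open>M z\<close>,
  \<open>E - cnj z\<close> turns it into an orthogonal term, and the two shifts of \<open>T\<close>
  have equal norms.\<close>

lemma E_contraction_at_z:
  assumes "x \<in> op_dom E"
  shows "norm (app E x - z *\<^sub>C x) \<le> norm (app E x - cnj z *\<^sub>C x)"
proof -
  obtain f \<phi> where f: "f \<in> op_dom T" "\<phi> \<in> M z" "x = f + \<phi>" using assms by (auto simp: dom_E)
  have "app E x - z *\<^sub>C x = app T f - z *\<^sub>C f" by (simp add: f app_E scaleC_simps)
  moreover have "app E x - cnj z *\<^sub>C x = (app T f - cnj z *\<^sub>C f) + (z - cnj z) *\<^sub>C \<phi>"
    by (simp add: f app_E scaleC_simps)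
  moreover have "cinner (app T f - cnj z *\<^sub>C f) ((z - cnj z) *\<^sub>C \<phi>) = 0"
    using cinner_defect(4)[OF f(2,1)] by (simp add: cinner_scaleC_right)
  ultimately have "(norm (app E x - z *\<^sub>C x))\<^sup>2 \<le> (norm (app E x - cnj z *\<^sub>C x))\<^sup>2"
    using shift_norm_cnj[OF f(1), of z] by (simp add: norm_add_square_orth)
  then show ?thesis by simp
qed

text \<open>
  With \<open>w = (E - cnj z) x\<close> and the Cayley transform \<open>(E - z) (E - cnj z)\<^sup>-\<^sup>1\<close>, the
  equation \<open>(E - cnj c) x = k\<close> becomes a fixed point equation for \<open>w\<close> with contraction constant
  \<open>|z - c| / |z - cnj c|\<close>.
\<close>
lemma E_surj:
  assumes c: "Im c > 0" and k: "k \<in> K"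
  shows "\<exists>x\<in>op_dom E. app E x - cnj c *\<^sub>C x = k"
proof -
  have "\<forall>w\<in>K. \<exists>x. x \<in> op_dom E \<and> app E x - cnj z *\<^sub>C x = w" using E_surj_at_z by blast
  then obtain R where R: "\<And>w. w \<in> K \<Longrightarrow> R w \<in> op_dom E"
    "\<And>w. w \<in> K \<Longrightarrow> app E (R w) - cnj z *\<^sub>C R w = w" by metis
  define G where "G w = app E (R w) - z *\<^sub>C R w" for w
  \<comment> \<open>With \<open>G w = (E - z) x\<close> the equation reads
    \<open>(z - cnj c) w - (cnj z - cnj c) G w = (z - cnj z) k\<close>; dividing by the first
    coefficient gives \<open>q\<close> and \<open>p\<close>.\<close>
  define q where "q = (cnj z - cnj c) / (z - cnj c)"
  define p where "p = (z - cnj z) / (z - cnj c)"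
  have nz: "z - cnj c \<noteq> 0" "z - cnj z \<noteq> 0" using z c by (auto simp: complex_eq_iff)
  \<comment> \<open>The squared moduli differ by \<open>4 * Im z * Im c\<close>.\<close>
  have "(cmod (cnj z - cnj c))\<^sup>2 < (cmod (z - cnj c))\<^sup>2"
    using mult_pos_pos[OF z c] by (simp add: cmod_power2) (simp add: power2_eq_square algebra_simps)
  then have "cmod (cnj z - cnj c) < cmod (z - cnj c)" by (simp add: power2_less_imp_less)
  then have q1: "cmod q < 1" using nz by (simp add: q_def norm_divide divide_less_eq)
  define F where "F w = p *\<^sub>C k + q *\<^sub>C G w" for w
  have FK: "F w \<in> K" if "w \<in> K" for w
  proof -
    have "G w \<in> K"
      unfolding G_def by (intro mem_diff mem_scale app_E_mem dom_E_mem R(1) that)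
    then show ?thesis unfolding F_def by (intro mem_add mem_scale k)
  qed
  \<comment> \<open>\<open>R\<close> comes from a choice; its additivity is recovered from
    injectivity of \<open>E - cnj z\<close>.\<close>
  have R_diff: "R w - R v = R (w - v)" if "w \<in> K" "v \<in> K" for w v
  proof (rule E_shift_inj[where c = z])
    have wv: "w - v \<in> K" using that by (rule mem_diff)
    show "R w - R v \<in> op_dom E" "R (w - v) \<in> op_dom E" using that wv R E_dom by auto
    have "app E (R w - R v) - cnj z *\<^sub>C (R w - R v)
        = (app E (R w) - cnj z *\<^sub>C R w) - (app E (R v) - cnj z *\<^sub>C R v)"
      by (simp add: E_lin R(1) that scaleC_simps)
    then show "app E (R w - R v) - cnj z *\<^sub>C (R w - R v) = app E (R (w - v)) - cnj z *\<^sub>C R (w - v)"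
      by (simp only: R(2) that wv)
  qed (rule z)
  have "dist (F w) (F v) \<le> cmod q * dist w v" if "w \<in> K" "v \<in> K" for w v
  proof -
    have wv: "w - v \<in> K" using that by (rule mem_diff)
    have "G w - G v = app E (R w - R v) - z *\<^sub>C (R w - R v)"
      by (simp add: G_def E_lin R(1) that scaleC_simps)
    also have "\<dots> = app E (R (w - v)) - z *\<^sub>C R (w - v)" by (simp add: R_diff that)
    finally have "norm (G w - G v) \<le> norm (w - v)"
      using E_contraction_at_z[OF R(1)[OF wv]] R(2)[OF wv] by simp
    moreover have "F w - F v = q *\<^sub>C (G w - G v)" by (simp add: F_def scaleC_simps)
    ultimately show ?thesis by (simp add: dist_norm norm_scaleC mult_left_mono)
  qed
  then have "\<exists>!w\<in>K. F w = w"
    using FK q1 mem_0 by (intro Banach_fix[OF complete, where c = "cmod q"]) auto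
  then obtain w where w: "w \<in> K" "F w = w" by blast
  define x where "x = R w"
  have x: "x \<in> op_dom E" using R w by (simp add: x_def)
  have "w = app E x - cnj z *\<^sub>C x" using R w by (simp add: x_def)
  moreover have "p *\<^sub>C k + q *\<^sub>C (app E x - z *\<^sub>C x) = w"
    using w(2) by (simp add: F_def G_def x_def)
  ultimately have "p *\<^sub>C k + q *\<^sub>C (app E x - z *\<^sub>C x) = app E x - cnj z *\<^sub>C x" by simp
  then have "p *\<^sub>C k = (1 - q) *\<^sub>C app E x - (cnj z - q * z) *\<^sub>C x"
    by (simp add: scaleC_simps scaleC_scaleC scaleC_one algebra_simps)
  moreover have "1 - q = p" using nz by (simp add: p_def q_def field_simps)
  moreover have "cnj z - q * z = p * cnj c"
  proof -
    have "(z - cnj c) * (cnj z - q * z) = (z - cnj c) * (p * cnj c)"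
      using nz by (simp add: p_def q_def right_diff_distrib) (simp add: algebra_simps)
    then show ?thesis using nz by simp
  qed
  ultimately have "p *\<^sub>C k = p *\<^sub>C (app E x - cnj c *\<^sub>C x)" by (simp add: scaleC_simps scaleC_scaleC)
  moreover have "p \<noteq> 0" using nz by (simp add: p_def)
  ultimately have "app E x - cnj c *\<^sub>C x = k" by (simp only: cvec.scale_cancel_left) simp
  then show ?thesis using x by blast
qed

section \<open>Resolvents and characteristic functions of Shtraus extensions\<close>

lemma resolvent_E:
  assumes c: "Im c > 0" and k: "k \<in> K"
  shows "resolvent E (cnj c) k \<in> op_dom E"
    and "app E (resolvent E (cnj c) k) - cnj c *\<^sub>C resolvent E (cnj c) k = k"
proof -
  have "k \<in> (\<lambda>x. app E x - cnj c *\<^sub>C x) ` op_dom E" using E_surj[OF c k] by blast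
  then show "resolvent E (cnj c) k \<in> op_dom E"
    and "app E (resolvent E (cnj c) k) - cnj c *\<^sub>C resolvent E (cnj c) k = k"
    unfolding resolvent_def by (rule inv_into_into, rule f_inv_into_f)
qed

text \<open>Since \<open>(E - c) x = (E - cnj c) x + (cnj c - c) x\<close>, any solution of the
  shifted equation computes the function, with no reference to \<open>inv_into\<close>.\<close>

lemma char_fun_eq:
  assumes c: "Im c > 0" and \<phi>: "\<phi> \<in> M c" and x: "x \<in> op_dom E" "app E x - cnj c *\<^sub>C x = \<phi>"
  shows "char_fun T M c z \<phi> = \<phi> + (cnj c - c) *\<^sub>C x"
proof -
  have "resolvent E (cnj c) \<phi> = x"
    by (rule E_shift_inj[OF resolvent_E(1)[OF c M_mem[OF \<phi>]] x(1) c])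
      (simp only: resolvent_E(2)[OF c M_mem[OF \<phi>]] x(2))
  then have "char_fun T M c z \<phi> = app E x - c *\<^sub>C x" using \<phi> by (simp add: char_fun_def Let_def)
  also have "\<dots> = \<phi> + (cnj c - c) *\<^sub>C x" by (simp add: x(2)[symmetric] scaleC_simps)
  finally show ?thesis .
qed

lemma char_fun_mem:
  assumes c: "Im c > 0" and \<phi>: "\<phi> \<in> M c"
  shows "char_fun T M c z \<phi> \<in> M (cnj c)"
proof -
  obtain x where x: "x \<in> op_dom E" "app E x - cnj c *\<^sub>C x = \<phi>" using E_surj[OF c M_mem[OF \<phi>]] by blast
  obtain f \<psi> where f: "f \<in> op_dom T" "\<psi> \<in> M z" "x = f + \<psi>" using x by (auto simp: dom_E)
  have eq: "char_fun T M c z \<phi> = app E x - c *\<^sub>C x"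
    using char_fun_eq[OF c \<phi> x] by (simp add: x(2)[symmetric] scaleC_simps)
  have "cinner (app E x - c *\<^sub>C x) (app T g - c *\<^sub>C g) = 0" if g: "g \<in> op_dom T" for g
  proof -
    \<comment> \<open>\<open>E\<close> acts as a weak adjoint of \<open>T\<close>: symmetry covers
      the part in \<open>op_dom T\<close>, the eigenvector relation the part in \<open>M z\<close>.
      Hence both shifts may be conjugated at once.\<close>
    have "cinner (app E x) g = cinner x (app T g)"
      by (simp add: f app_E cinner_simps cinner_defect(1)[OF f(2) g] app_symmetric[OF f(1) g])
    then have "cinner (app E x - c *\<^sub>C x) (app T g - c *\<^sub>C g)
        = cinner (app E x - cnj c *\<^sub>C x) (app T g - cnj c *\<^sub>C g)"
      by (simp add: cinner_simps algebra_simps)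
    then show ?thesis using cinner_defect(3)[OF \<phi> g] x(2) by simp
  qed
  moreover have "app E x - c *\<^sub>C x \<in> K" by (intro mem_diff mem_scale app_E_mem dom_E_mem x)
  ultimately show ?thesis unfolding eq by (auto simp: M_def ominus_def ran_shift_def)
qed

text \<open>One part of the constant comes from \<open>\<phi>\<close>, two from
  \<open>2 * Im c * norm x\<close>, which \<open>E_shift_lower\<close> bounds.\<close>

lemma norm_char_fun_le:
  assumes c: "Im c > 0" and \<phi>: "\<phi> \<in> M c"
  shows "norm (char_fun T M c z \<phi>) \<le> 3 * norm \<phi>"
proof -
  obtain x where x: "x \<in> op_dom E" "app E x - cnj c *\<^sub>C x = \<phi>" using E_surj[OF c M_mem[OF \<phi>]] by blast
  have "cnj c - c = complex_of_real (2 * Im c) * (- \<i>)" by (simp add: complex_eq_iff)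
  then have "cmod (cnj c - c) = 2 * Im c" using c by (simp only: norm_mult) simp
  then have "norm (char_fun T M c z \<phi>) \<le> norm \<phi> + 2 * (Im c * norm x)"
    unfolding char_fun_eq[OF c \<phi> x] by (intro order_trans[OF norm_triangle_ineq]) (simp add: norm_scaleC)
  then show ?thesis using E_shift_lower[OF x(1) c] x(2) by simp
qed

lemma char_fun_bounded:
  assumes c: "Im c > 0"
  shows "char_fun T M c z \<in> bounded_operators (M c) (M (cnj c))"
proof -
  interpret Mc: hilbert_subspace "M c" by (rule M_subspace)
  have add: "char_fun T M c z (\<phi> + \<psi>) = char_fun T M c z \<phi> + char_fun T M c z \<psi>"
    if \<phi>: "\<phi> \<in> M c" and \<psi>: "\<psi> \<in> M c" for \<phi> \<psi>
  proof -
    obtain x where x: "x \<in> op_dom E" "app E x - cnj c *\<^sub>C x = \<phi>" using E_surj[OF c M_mem[OF \<phi>]] by blast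
    obtain y where y: "y \<in> op_dom E" "app E y - cnj c *\<^sub>C y = \<psi>" using E_surj[OF c M_mem[OF \<psi>]] by blast
    have "app E (x + y) - cnj c *\<^sub>C (x + y) = \<phi> + \<psi>"
      by (simp add: x(2)[symmetric] y(2)[symmetric] E_lin x(1) y(1) scaleC_simps)
    from char_fun_eq[OF c Mc.mem_add[OF \<phi> \<psi>] E_dom(2)[OF x(1) y(1)] this]
    show ?thesis by (simp add: char_fun_eq[OF c \<phi> x] char_fun_eq[OF c \<psi> y] scaleC_simps)
  qed
  have scale: "char_fun T M c z (d *\<^sub>C \<phi>) = d *\<^sub>C char_fun T M c z \<phi>"
    if \<phi>: "\<phi> \<in> M c" for \<phi> d
  proof -
    obtain x where x: "x \<in> op_dom E" "app E x - cnj c *\<^sub>C x = \<phi>" using E_surj[OF c M_mem[OF \<phi>]] by blast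
    have "app E (d *\<^sub>C x) - cnj c *\<^sub>C (d *\<^sub>C x) = d *\<^sub>C \<phi>"
      by (simp add: x(2)[symmetric] E_lin x(1) scaleC_simps scaleC_scaleC mult.commute)
    from char_fun_eq[OF c Mc.mem_scale[OF \<phi>] E_dom(4)[OF x(1)] this]
    show ?thesis by (simp add: char_fun_eq[OF c \<phi> x] scaleC_simps scaleC_scaleC algebra_simps)
  qed
  show ?thesis unfolding bounded_operators_def
    using add scale char_fun_mem[OF c] norm_char_fun_le[OF c] by blast
qed

end


section \<open>The operator and its compression to the closure of its domain\<close>

lemma inverse_bounded_operator:
  fixes D :: "'a::complex_inner \<Rightarrow> 'a"
  assumes L: "cvec.subspace L" and bij: "bij_betw D L L'"
    and add: "\<And>x y. x \<in> L \<Longrightarrow> y \<in> L \<Longrightarrow> D (x + y) = D x + D y"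
    and scale: "\<And>c x. x \<in> L \<Longrightarrow> D (c *\<^sub>C x) = c *\<^sub>C D x"
    and bound: "\<And>x. x \<in> L \<Longrightarrow> norm x \<le> b * norm (D x)"
  shows "inv_into L D \<in> bounded_operators L' L"
proof -
  have inj: "inj_on D L" and im: "D ` L = L'" using bij by (auto simp: bij_betw_def)
  have eq: "inv_into L D (D x) = x" if "x \<in> L" for x using inj that by (rule inv_into_f_f)
  have "inv_into L D (D x + D y) = x + y" if "x \<in> L" "y \<in> L" for x y
    using eq[of "x + y"] that L by (simp add: add cvec.subspace_add)
  moreover have "inv_into L D (c *\<^sub>C D x) = c *\<^sub>C x" if "x \<in> L" for c x
    using eq[of "c *\<^sub>C x"] that L by (simp add: scale cvec.subspace_scale)
  ultimately show ?thesis
    unfolding bounded_operators_def im[symmetric] using bound by (auto simp: eq intro!: exI[of _ b])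
qed

lemma proj_add_proj_ominus:
  fixes N :: "'a::complex_hilbert set"
  assumes N: "closed_csubspace N" and M: "closed_csubspace M" and MN: "M \<subseteq> N" and x: "x \<in> N"
  shows "proj (ominus N M) x + proj M x = x"
proof -
  interpret N: hilbert_subspace N using N by unfold_locales
  interpret M: hilbert_subspace M using M by unfold_locales
  interpret L: hilbert_subspace "ominus N M" using closed_csubspace_ominus[OF N] by unfold_locales
  have "proj (ominus N M) x = x - proj M x"
  proof (rule L.proj_eqI)
    show "x - proj M x \<in> ominus N M"
      using M.proj_mem[of x] MN x M.proj_orth[of x] N.mem_diff by (auto simp: ominus_def)
    fix k assume "k \<in> ominus N M"
    then show "cinner (x - (x - proj M x)) k = 0"
      using M.proj_mem[of x] by (simp add: ominusD')
  qed
  then show ?thesis by simp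
qed

locale regular_symmetric_pair =
  fixes S :: "'a::complex_hilbert operator" and \<mu> z :: complex
  assumes lin_S: "linear_op S" and closed_S: "closed_op S" and symm_S: "symmetric_op S"
    and regular_S: "regular S" and Im_mu: "Im \<mu> > 0" and Im_z: "Im z > 0"
begin

section \<open>Compression to \<open>H0 S\<close> and the splitting of the deficiency
  subspaces\<close>

lemma closed_csubspace_H0: "closed_csubspace (H0 S)"
  unfolding H0_def using linear_op_D(1)[OF lin_S] by (rule closure_csubspace)

sublocale H: hilbert_subspace "H0 S"
  by unfold_locales (rule closed_csubspace_H0)

sublocale L: hilbert_subspace "Lspace S"
  unfolding Lspace_def by unfold_locales (rule closed_csubspace_ominus[OF closed_csubspace_UNIV])

lemma op_dom_S0 [simp]: "op_dom (S0 S) = op_dom S"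
  and app_S0 [simp]: "app (S0 S) f = proj (H0 S) (app S f)"
  by (simp_all add: S0_def)

lemma dom_H0: "f \<in> op_dom S \<Longrightarrow> f \<in> H0 S"
  unfolding H0_def using closure_subset by blast

sublocale full: shtraus_extension UNIV S z
  by unfold_locales (auto simp: closed_csubspace_UNIV lin_S closed_S symm_S Im_z)

sublocale reduced: shtraus_extension "H0 S" "S0 S" z
proof unfold_locales
  show "linear_op (S0 S)" using lin_S by (simp add: linear_op_def H.proj_add H.proj_scaleC)
  \<comment> \<open>Regularity enters here: it gives \<open>S0 S\<close> closed shifted ranges in
    \<open>H0 S\<close>.\<close>
  show "closed_op (S0 S)" using regular_S by (simp add: regular_def)
  show "symmetric_op (S0 S)"
    using symm_S by (simp add: symmetric_op_def H.cinner_proj_left dom_H0)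
qed (auto simp: Im_z dom_H0 H.proj_mem)

lemma full_M: "full.M = defect S"
  by (simp add: fun_eq_iff full.M_def defect_def)

lemma H0_eq: "H0 S = ominus UNIV (Lspace S)"
  by (simp add: Lspace_def H.ominus_ominus)

lemma cinner_H0_Lspace: "x \<in> H0 S \<Longrightarrow> h \<in> Lspace S \<Longrightarrow> cinner x h = 0 \<and> cinner h x = 0"
  by (simp add: Lspace_def ominusD ominusD')

lemma Lspace_iff: "h \<in> Lspace S \<longleftrightarrow> proj (H0 S) h = 0"
proof
  show "h \<in> Lspace S \<Longrightarrow> proj (H0 S) h = 0" by (rule H.proj_eq_0) (simp add: cinner_H0_Lspace)
  show "proj (H0 S) h = 0 \<Longrightarrow> h \<in> Lspace S" using H.proj_orth[of h] by (simp add: Lspace_def)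
qed

lemma H0_iff: "x \<in> H0 S \<longleftrightarrow> proj (Lspace S) x = 0"
proof
  show "x \<in> H0 S \<Longrightarrow> proj (Lspace S) x = 0" by (rule L.proj_eq_0) (simp add: cinner_H0_Lspace)
  show "proj (Lspace S) x = 0 \<Longrightarrow> x \<in> H0 S" using L.proj_orth[of x] by (simp add: H0_eq)
qed

lemma N_subspace: "hilbert_subspace (defect S c)"
  using full.M_subspace by (simp add: full_M)

text \<open>For \<open>x\<close> in the deficiency subspace, orthogonality to
  \<open>proj (defect S c) h\<close> is orthogonality to \<open>h\<close>, and the complement of
  \<open>Lspace S\<close> is \<open>H0 S\<close>.\<close>

lemma semi_defect_eq: "semi_defect S c = defect S c \<inter> H0 S"
proof -
  interpret N: hilbert_subspace "defect S c" by (rule N_subspace)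
  have "cinner x (proj (defect S c) h) = cinner x h" if "x \<in> defect S c" for x h
    using that by (rule N.cinner_proj_right)
  then show ?thesis by (auto simp: semi_defect_def Ldefect_def H0_eq ominus_def)
qed

text \<open>Vectors of \<open>H0 S\<close> cannot distinguish \<open>app S f\<close> from its
  projection. The reduced extension is therefore the one inside \<open>C_S0\<close>.\<close>

lemma reduced_M: "reduced.M = semi_defect S"
proof (rule ext, rule set_eqI)
  fix c x
  have "cinner x (proj (H0 S) (app S f) - cnj c *\<^sub>C f) = cinner x (app S f - cnj c *\<^sub>C f)"
    if "x \<in> H0 S" for f
    using that by (simp add: cinner_simps H.cinner_proj_right)
  then show "x \<in> reduced.M c \<longleftrightarrow> x \<in> semi_defect S c"
    by (auto simp: semi_defect_eq reduced.M_def defect_def ominus_def ran_shift_def)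
qed

lemma M_subspace: "hilbert_subspace (semi_defect S c)"
  using reduced.M_subspace by (simp add: reduced_M)

lemma semi_defect_subset: "semi_defect S c \<subseteq> defect S c" "semi_defect S c \<subseteq> H0 S"
  by (auto simp: semi_defect_eq)

lemma proj_defect_ran:
  assumes "f \<in> op_dom S" shows "proj (defect S c) (app S f - cnj c *\<^sub>C f + h) = proj (defect S c) h"
proof -
  interpret N: hilbert_subspace "defect S c" by (rule N_subspace)
  have "proj (defect S c) (app S f - cnj c *\<^sub>C f) = 0"
    using assms full.cinner_defect(4) by (intro N.proj_eq_0) (simp add: full_M)
  then show ?thesis by (simp add: N.proj_add)
qed

lemma proj_defect_decomposition:
  assumes "Im c \<noteq> 0"
  obtains f where "f \<in> op_dom S" "h = app S f - cnj c *\<^sub>C f + proj (defect S c) h"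
proof -
  interpret N: hilbert_subspace "defect S c" by (rule N_subspace)
  obtain f \<phi> where f: "f \<in> op_dom S" "\<phi> \<in> defect S c" "h = app S f - cnj c *\<^sub>C f + \<phi>"
    using full.defect_decomposition[OF assms, of h] by (auto simp: full_M)
  then have "proj (defect S c) h = \<phi>" by (simp add: proj_defect_ran N.proj_ident)
  then show ?thesis using f that by blast
qed

text \<open>If \<open>x\<close> is orthogonal to \<open>semi_defect S c\<close>, the splitting of
  \<open>H0 S\<close> by \<open>S0 S\<close> puts \<open>proj (H0 S) x\<close> into the shifted
  range. In this form \<open>Ldefect S c\<close>, defined as an image, is visibly closed.\<close>

lemma Ldefect_eq:
  assumes c: "Im c \<noteq> 0"
  shows "Ldefect S c = ominus (defect S c) (semi_defect S c)"
proof
  interpret N: hilbert_subspace "defect S c" by (rule N_subspace)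
  show "Ldefect S c \<subseteq> ominus (defect S c) (semi_defect S c)"
    by (auto simp: Ldefect_def ominus_def N.proj_mem N.cinner_proj_left semi_defect_eq cinner_H0_Lspace)
  show "ominus (defect S c) (semi_defect S c) \<subseteq> Ldefect S c"
  proof
    fix x assume x: "x \<in> ominus (defect S c) (semi_defect S c)"
    then have xN: "x \<in> defect S c" by (simp add: ominus_def)
    have xH: "proj (H0 S) x \<in> H0 S" by (rule H.proj_mem)
    obtain f \<phi> where f: "f \<in> op_dom S" "\<phi> \<in> semi_defect S c"
      "proj (H0 S) x = app (S0 S) f - cnj c *\<^sub>C f + \<phi>"
      using reduced.defect_decomposition[OF c xH] by (auto simp: reduced_M)
    have "cinner \<phi> (app (S0 S) f - cnj c *\<^sub>C f) = 0"
      using reduced.cinner_defect(3)[of \<phi> c f] f by (simp add: reduced_M)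
    moreover have "cinner \<phi> (proj (H0 S) x) = cinner \<phi> x"
      using f(2) by (simp add: H.cinner_proj_right semi_defect_eq)
    moreover have "cinner \<phi> x = 0" using x f(2) by (rule ominusD')
    ultimately have "cinner \<phi> \<phi> = 0" by (simp add: f(3) cinner_add_right)
    then have eq: "proj (H0 S) x = app (S0 S) f - cnj c *\<^sub>C f" using f(3) by simp
    \<comment> \<open>Subtracting a vector of the shifted range of \<open>S\<close> clears the
      \<open>H0 S\<close> component of \<open>x\<close> and leaves its projection to the deficiency
      subspace unchanged.\<close>
    define h where "h = x - (app S f - cnj c *\<^sub>C f)"
    have "proj (H0 S) h = 0"
      using f(1) by (simp add: h_def H.proj_diff H.proj_scaleC eq H.proj_ident[OF dom_H0])
    then have "h \<in> Lspace S" by (simp add: Lspace_iff)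
    moreover have "proj (defect S c) h = x"
      using proj_defect_ran[OF f(1), of c h] by (simp add: h_def N.proj_ident[OF xN])
    ultimately show "x \<in> Ldefect S c" unfolding Ldefect_def by blast
  qed
qed

lemma Ldefect_subspace: "Im c \<noteq> 0 \<Longrightarrow> hilbert_subspace (Ldefect S c)"
  using closed_csubspace_ominus[OF hilbert_subspace.closed_csubspace[OF N_subspace]]
  by (simp add: Ldefect_eq hilbert_subspace_def)

lemma Ldefect_subset: "Ldefect S c \<subseteq> defect S c"
  using hilbert_subspace.proj_mem[OF N_subspace] by (auto simp: Ldefect_def)

lemma defect_proj_sum:
  "Im c \<noteq> 0 \<Longrightarrow> x \<in> defect S c \<Longrightarrow> proj (Ldefect S c) x + proj (semi_defect S c) x = x"
  unfolding Ldefect_eq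
  by (intro proj_add_proj_ominus hilbert_subspace.closed_csubspace N_subspace M_subspace
      semi_defect_subset)

lemma cinner_Ldefect_semi_defect:
  "Im c \<noteq> 0 \<Longrightarrow> x \<in> Ldefect S c \<Longrightarrow> y \<in> semi_defect S c \<Longrightarrow> cinner x y = 0 \<and> cinner y x = 0"
  by (simp add: Ldefect_eq ominusD ominusD')

lemma proj_Ldefect_semi_defect:
  "Im c \<noteq> 0 \<Longrightarrow> y \<in> semi_defect S c \<Longrightarrow> proj (Ldefect S c) y = 0"
  by (rule hilbert_subspace.proj_eq_0[OF Ldefect_subspace]) (auto simp: cinner_Ldefect_semi_defect)

lemma proj_semi_defect_Ldefect:
  "Im c \<noteq> 0 \<Longrightarrow> x \<in> Ldefect S c \<Longrightarrow> proj (semi_defect S c) x = 0"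
  by (rule hilbert_subspace.proj_eq_0[OF M_subspace]) (auto simp: cinner_Ldefect_semi_defect)

text \<open>An \<open>h\<close> killed by the projection is \<open>(S - cnj c) f\<close>; being
  orthogonal to \<open>f\<close>, it leaves \<open>Im c\<close> times the squared norm of
  \<open>f\<close> equal to zero. This makes \<open>V\<close> well defined.\<close>

lemma proj_defect_inj:
  assumes c: "Im c \<noteq> 0" and h: "h \<in> Lspace S" and "proj (defect S c) h = 0"
  shows "h = 0"
proof -
  obtain f where f: "f \<in> op_dom S" "h = app S f - cnj c *\<^sub>C f"
    using proj_defect_decomposition[OF c, of h] assms(3) by auto
  have "cinner h f = 0" using cinner_H0_Lspace[OF dom_H0[OF f(1)] h] by simp
  then have "Im (cinner (app S f) f) + Im c * (norm f)\<^sup>2 = 0"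
    by (simp add: f(2) cinner_simps cinner_self complex_eq_iff)
  then have "f = 0" using c full.cinner_app_self[OF f(1)] by simp
  then show ?thesis using f(2) by (simp add: linear_op_zero[OF lin_S])
qed

section \<open>The map \<open>V\<close> between the two projections of
  \<open>Lspace S\<close>\<close>

lemma V_proj:
  assumes c: "Im c \<noteq> 0" and h: "h \<in> Lspace S"
  shows "V S c (proj (defect S c) h) = proj (defect S (cnj c)) h"
  unfolding V_def
proof (rule the_equality)
  show "\<exists>k\<in>Lspace S. proj (defect S c) h = proj (defect S c) k
      \<and> proj (defect S (cnj c)) h = proj (defect S (cnj c)) k"
    using h by blast
  fix y assume "\<exists>k\<in>Lspace S. proj (defect S c) h = proj (defect S c) k \<and> y = proj (defect S (cnj c)) k"
  then obtain k where k: "k \<in> Lspace S" "proj (defect S c) h = proj (defect S c) k"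
    "y = proj (defect S (cnj c)) k" by blast
  have "h - k = 0"
    by (rule proj_defect_inj[OF c]) (auto simp: h k L.mem_diff hilbert_subspace.proj_diff[OF N_subspace])
  then show "y = proj (defect S (cnj c)) h" using k by simp
qed

lemma V_mem: "Im c \<noteq> 0 \<Longrightarrow> n \<in> Ldefect S c \<Longrightarrow> V S c n \<in> Ldefect S (cnj c)"
  by (auto simp: Ldefect_def V_proj)

lemma V_add:
  assumes c: "Im c \<noteq> 0" and "x \<in> Ldefect S c" "y \<in> Ldefect S c"
  shows "V S c (x + y) = V S c x + V S c y"
proof -
  obtain h k where "h \<in> Lspace S" "x = proj (defect S c) h" "k \<in> Lspace S" "y = proj (defect S c) k"
    using assms by (auto simp: Ldefect_def)
  then show ?thesis using V_proj[OF c L.mem_add, of h k]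
    by (simp add: V_proj c hilbert_subspace.proj_add[OF N_subspace])
qed

lemma V_scaleC:
  assumes c: "Im c \<noteq> 0" and "x \<in> Ldefect S c"
  shows "V S c (d *\<^sub>C x) = d *\<^sub>C V S c x"
proof -
  obtain h where "h \<in> Lspace S" "x = proj (defect S c) h" using assms by (auto simp: Ldefect_def)
  then show ?thesis using V_proj[OF c L.mem_scale, of h d]
    by (simp add: V_proj c hilbert_subspace.proj_scaleC[OF N_subspace])
qed

text \<open>Regrouping gives \<open>h = (S - c) f + (n + (c - cnj c) f)\<close>; as \<open>h\<close>
  is orthogonal to \<open>op_dom S\<close>, the bracket lies in \<open>defect S (cnj c)\<close> and
  so is the other projection of \<open>h\<close>.\<close>

lemma V_eq:
  assumes c: "Im c \<noteq> 0" and h: "h \<in> Lspace S" and f: "f \<in> op_dom S"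
    and eq: "h = app S f - cnj c *\<^sub>C f + n" and n: "n \<in> defect S c"
  shows "V S c n = n + (c - cnj c) *\<^sub>C f"
proof -
  interpret N': hilbert_subspace "defect S (cnj c)" by (rule N_subspace)
  have pn: "proj (defect S c) h = n"
    unfolding eq by (simp add: proj_defect_ran f hilbert_subspace.proj_ident[OF N_subspace] n)
  have hn: "h = app S f - c *\<^sub>C f + (n + (c - cnj c) *\<^sub>C f)" by (simp add: eq scaleC_simps)
  have "cinner (n + (c - cnj c) *\<^sub>C f) (app S g - c *\<^sub>C g) = 0" if g: "g \<in> op_dom S" for g
  proof -
    have hg: "cinner h g = 0" using cinner_H0_Lspace[OF dom_H0[OF g] h] by simp
    have sym: "cinner (app S f) g = cinner f (app S g)" by (rule full.app_symmetric[OF f g])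
    have ng: "cinner n (app S g) = c * cinner n g"
      using full.cinner_defect(1)[of n c g] n g by (simp add: full_M)
    have "cinner f (app S g) - cnj c * cinner f g + cinner n g = 0"
      using hg by (simp add: eq cinner_simps sym)
    then have fg: "cinner f (app S g) = cnj c * cinner f g - cinner n g" by (simp add: algebra_simps)
    show ?thesis by (simp add: cinner_simps ng fg algebra_simps)
  qed
  then have "n + (c - cnj c) *\<^sub>C f \<in> defect S (cnj c)"
    by (auto simp: defect_def ominus_def ran_shift_def)
  then have "proj (defect S (cnj c)) h = n + (c - cnj c) *\<^sub>C f"
    using proj_defect_ran[OF f, of "cnj c" "n + (c - cnj c) *\<^sub>C f"] unfolding hn
    by (simp add: N'.proj_ident)
  then show ?thesis using V_proj[OF c h] by (simp add: pn)
qed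

section \<open>The characteristic functions of \<open>S\<close> and \<open>S0 S\<close>\<close>

lemma C_S_eq:
  "\<phi> \<in> defect S \<mu> \<Longrightarrow> x \<in> op_dom full.E \<Longrightarrow> app full.E x - cnj \<mu> *\<^sub>C x = \<phi> \<Longrightarrow>
    C_S S \<mu> z \<phi> = \<phi> + (cnj \<mu> - \<mu>) *\<^sub>C x"
  using full.char_fun_eq[OF Im_mu] by (simp add: C_S_def full_M)

lemma C_S_bounded: "C_S S \<mu> z \<in> bounded_operators (defect S \<mu>) (defect S (cnj \<mu>))"
  using full.char_fun_bounded[OF Im_mu] by (simp add: C_S_def full_M)

lemma C_S0_bounded: "C_S0 S \<mu> z \<in> bounded_operators (semi_defect S \<mu>) (semi_defect S (cnj \<mu>))"
  using reduced.char_fun_bounded[OF Im_mu] by (simp add: C_S0_def reduced_M)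

lemma nonreal: "Im \<mu> \<noteq> 0" "Im (cnj \<mu>) \<noteq> 0" "Im z \<noteq> 0" "cnj \<mu> - \<mu> \<noteq> 0"
  using Im_mu Im_z by (auto simp: complex_eq_iff)

text \<open>
  On \<open>Ldefect S \<mu>\<close> the isometry \<open>V\<close> is given by the formula for the characteristic function, with
  a vector of \<open>op_dom S\<close> in place of the resolvent; hence the difference of the two is again
  governed by the resolvent, now applied to \<open>Lspace S\<close>.
\<close>
lemma C_S_minus_V:
  assumes h: "h \<in> Lspace S" and y: "y \<in> op_dom full.E" "app full.E y - cnj \<mu> *\<^sub>C y = h"
  shows "C_S S \<mu> z (proj (defect S \<mu>) h) - V S \<mu> (proj (defect S \<mu>) h) = (cnj \<mu> - \<mu>) *\<^sub>C y"
proof -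
  interpret N: hilbert_subspace "defect S \<mu>" by (rule N_subspace)
  define n where "n = proj (defect S \<mu>) h"
  have n: "n \<in> defect S \<mu>" by (simp add: n_def N.proj_mem)
  obtain f where f: "f \<in> op_dom S" "h = app S f - cnj \<mu> *\<^sub>C f + n"
    using proj_defect_decomposition[OF nonreal(1), of h] n_def by blast
  have 0: "0 \<in> full.M z" using hilbert_subspace.mem_0[OF full.M_subspace] .
  have fE: "f \<in> op_dom full.E" "app full.E f = app S f"
    using full.dom_EI[OF f(1) 0] full.app_E[OF f(1) 0] by simp_all
  \<comment> \<open>\<open>E\<close> extends \<open>S\<close>, so removing \<open>f\<close> from the
    solution for \<open>h\<close> leaves the solution for \<open>n\<close>.\<close>
  have "app full.E (y - f) - cnj \<mu> *\<^sub>C (y - f) = n"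
    using y(2) f(2) by (simp add: full.E_lin y(1) fE scaleC_simps algebra_simps)
  note C = C_S_eq[OF n full.E_dom(3)[OF y(1) fE(1)] this]
  show ?thesis
    unfolding n_def[symmetric] C V_eq[OF nonreal(1) h f n] by (simp add: scaleC_simps)
qed

section \<open>The corner \<open>A11 - V\<close> and its injectivity\<close>

definition D :: "'a \<Rightarrow> 'a" where "D x = A11 S \<mu> z x - V S \<mu> x"

abbreviation "N \<equiv> defect S \<mu>"
abbreviation "N' \<equiv> defect S (cnj \<mu>)"
abbreviation "M\<^sub>0 \<equiv> semi_defect S \<mu>"
abbreviation "M\<^sub>0' \<equiv> semi_defect S (cnj \<mu>)"
abbreviation "L\<^sub>0 \<equiv> Ldefect S \<mu>"
abbreviation "L\<^sub>0' \<equiv> Ldefect S (cnj \<mu>)"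

sublocale N: hilbert_subspace N by (rule N_subspace)
sublocale N': hilbert_subspace N' by (rule N_subspace)
sublocale M0: hilbert_subspace M\<^sub>0 by (rule M_subspace)
sublocale M0': hilbert_subspace M\<^sub>0' by (rule M_subspace)
sublocale L0: hilbert_subspace L\<^sub>0 by (rule Ldefect_subspace[OF nonreal(1)])
sublocale L0': hilbert_subspace L\<^sub>0' by (rule Ldefect_subspace[OF nonreal(2)])

lemma C_add: "x \<in> N \<Longrightarrow> y \<in> N \<Longrightarrow> C_S S \<mu> z (x + y) = C_S S \<mu> z x + C_S S \<mu> z y"
  and C_scaleC: "x \<in> N \<Longrightarrow> C_S S \<mu> z (c *\<^sub>C x) = c *\<^sub>C C_S S \<mu> z x"
  and C_mem: "x \<in> N \<Longrightarrow> C_S S \<mu> z x \<in> N'"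
  using C_S_bounded by (auto simp: bounded_operators_def)

lemma L0_N: "x \<in> L\<^sub>0 \<Longrightarrow> x \<in> N" and L0'_N': "x \<in> L\<^sub>0' \<Longrightarrow> x \<in> N'"
  and M0_N: "x \<in> M\<^sub>0 \<Longrightarrow> x \<in> N"
  using Ldefect_subset semi_defect_subset by blast+

lemma V_mem': "x \<in> L\<^sub>0 \<Longrightarrow> V S \<mu> x \<in> L\<^sub>0'"
  by (rule V_mem[OF nonreal(1)])

text \<open>\<open>V\<close> already maps into \<open>L\<^sub>0'\<close>, so the corner is a
  compression of \<open>C - V\<close>, to which the resolvent formula applies.\<close>

lemma D_eq: "x \<in> L\<^sub>0 \<Longrightarrow> D x = proj L\<^sub>0' (C_S S \<mu> z x - V S \<mu> x)"
  by (simp add: D_def A11_def L0'.proj_diff L0'.proj_ident V_mem')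

lemma D_mem: "x \<in> L\<^sub>0 \<Longrightarrow> D x \<in> L\<^sub>0'"
  by (simp add: D_eq L0'.proj_mem)

lemma D_add: "x \<in> L\<^sub>0 \<Longrightarrow> y \<in> L\<^sub>0 \<Longrightarrow> D (x + y) = D x + D y"
  by (simp add: D_eq L0.mem_add C_add L0_N V_add[OF nonreal(1)] L0'.proj_add L0'.proj_diff)

lemma D_scaleC: "x \<in> L\<^sub>0 \<Longrightarrow> D (c *\<^sub>C x) = c *\<^sub>C D x"
  by (simp add: D_eq L0.mem_scale C_scaleC L0_N V_scaleC[OF nonreal(1)] L0'.proj_scaleC
      cvec.scale_right_diff_distrib[symmetric])

lemma D_proj:
  assumes "h \<in> Lspace S" "y \<in> op_dom full.E" "app full.E y - cnj \<mu> *\<^sub>C y = h"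
  shows "D (proj N h) = proj L\<^sub>0' ((cnj \<mu> - \<mu>) *\<^sub>C y)" and "(cnj \<mu> - \<mu>) *\<^sub>C y \<in> N'"
proof -
  have n: "proj N h \<in> L\<^sub>0" using assms(1) by (simp add: Ldefect_def)
  then have "C_S S \<mu> z (proj N h) - V S \<mu> (proj N h) \<in> N'"
    by (intro N'.mem_diff C_mem L0_N L0'_N' V_mem')
  then show "D (proj N h) = proj L\<^sub>0' ((cnj \<mu> - \<mu>) *\<^sub>C y)" "(cnj \<mu> - \<mu>) *\<^sub>C y \<in> N'"
    using D_eq[OF n] C_S_minus_V[OF assms] by simp_all
qed

text \<open>If \<open>D n = 0\<close>, then \<open>y\<close> lies in \<open>H0 S\<close> and is
  orthogonal to \<open>h = (E - cnj \<mu>) y\<close>; dissipativity then forces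
  \<open>y = 0\<close>.\<close>

lemma D_kernel:
  assumes n: "n \<in> L\<^sub>0" and "D n = 0" shows "n = 0"
proof -
  obtain h where h: "h \<in> Lspace S" "n = proj N h" using n by (auto simp: Ldefect_def)
  obtain y where y: "y \<in> op_dom full.E" "app full.E y - cnj \<mu> *\<^sub>C y = h"
    using full.E_surj[OF Im_mu, of h] by auto
  define y' where "y' = (cnj \<mu> - \<mu>) *\<^sub>C y"
  have "y' \<in> N'" "proj L\<^sub>0' y' = 0" using D_proj[OF h(1) y] assms h by (simp_all add: y'_def)
  then have "y' \<in> M\<^sub>0'" using defect_proj_sum[OF nonreal(2), of y'] M0'.proj_mem[of y'] by simp
  then have "y' \<in> H0 S" using semi_defect_subset by blast
  then have "inverse (cnj \<mu> - \<mu>) *\<^sub>C y' \<in> H0 S" by (rule H.mem_scale)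
  then have "y \<in> H0 S" using nonreal(4) by (simp add: y'_def scaleC_scaleC scaleC_one)
  then have "cinner h y = 0" using cinner_H0_Lspace h(1) by blast
  then have "Im (cinner (app full.E y) y) + Im \<mu> * (norm y)\<^sup>2 = 0"
    using full.E_shift_Im[of y \<mu>] by (simp add: y(2))
  then have "Im \<mu> * (norm y)\<^sup>2 \<le> 0" using full.E_dissipative[OF y(1)] by linarith
  then have "y = 0" using Im_mu by (simp add: mult_le_0_iff)
  then have "h = 0" using y(2) full.E_lin(4) by simp
  then show ?thesis by (simp add: h(2) N.proj_eq_0)
qed

section \<open>Lifting vectors of \<open>Lspace S\<close> to deficiency subspaces\<close>

text \<open>
  The bounded map \<open>proj (defect S c)\<close> from \<open>Lspace S\<close> onto the closed subspace \<open>Ldefect S c\<close>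
  is injective; the uniform boundedness principle makes its adjoint \<open>proj (Lspace S)\<close> bounded below.
\<close>
lemma Lspace_lift_bounded_below:
  assumes c: "Im c \<noteq> 0"
  shows "\<exists>b. \<forall>\<phi>\<in>Ldefect S c. norm \<phi> \<le> b * norm (proj (Lspace S) \<phi>)"
proof -
  interpret Nc: hilbert_subspace "defect S c" by (rule N_subspace)
  interpret Lc: hilbert_subspace "Ldefect S c" by (rule Ldefect_subspace[OF c])
  define B where "B = {\<phi> \<in> Ldefect S c. norm (proj (Lspace S) \<phi>) \<le> 1}"
  have adj: "cinner (proj (defect S c) h) \<phi> = cinner h (proj (Lspace S) \<phi>)"
    if "h \<in> Lspace S" "\<phi> \<in> Ldefect S c" for h \<phi>
  proof -
    have "\<phi> \<in> defect S c" using Ldefect_subset that by blast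
    then show ?thesis by (simp add: Nc.cinner_proj_left L.cinner_proj_right[OF that(1)])
  qed
  have "\<exists>b. \<forall>\<phi>\<in>B. norm \<phi> \<le> b"
  proof (rule weakly_bounded_imp_bounded)
    fix w
    \<comment> \<open>On \<open>B\<close> only the component of \<open>w\<close> in
      \<open>Ldefect S c\<close> matters. It is \<open>proj (defect S c) h\<close> for some
      \<open>h\<close>, and \<open>norm h\<close> then bounds the functional on all of
      \<open>B\<close>.\<close>
    obtain h where h: "h \<in> Lspace S" "proj (Ldefect S c) w = proj (defect S c) h"
      using Lc.proj_mem[of w] unfolding Ldefect_def by blast
    have "cmod (cinner w \<phi>) \<le> norm h" if "\<phi> \<in> B" for \<phi>
    proof -
      have \<phi>: "\<phi> \<in> Ldefect S c" "norm (proj (Lspace S) \<phi>) \<le> 1" using that by (auto simp: B_def)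
      have "cinner w \<phi> = cinner h (proj (Lspace S) \<phi>)"
        using Lc.cinner_proj_left[OF \<phi>(1), of w] adj[OF h(1) \<phi>(1)] h(2) by simp
      then have "cmod (cinner w \<phi>) \<le> norm h * norm (proj (Lspace S) \<phi>)"
        by (simp add: cauchy_schwarz)
      also have "\<dots> \<le> norm h * 1" by (rule mult_left_mono[OF \<phi>(2)]) simp
      finally show ?thesis by simp
    qed
    then show "\<exists>b. \<forall>\<phi>\<in>B. cmod (cinner w \<phi>) \<le> b" by blast
  qed
  then obtain b where b: "\<And>\<phi>. \<phi> \<in> B \<Longrightarrow> norm \<phi> \<le> b" by blast
  have "norm \<phi> \<le> b * norm (proj (Lspace S) \<phi>)" if \<phi>: "\<phi> \<in> Ldefect S c" for \<phi>
  proof (cases "proj (Lspace S) \<phi> = 0")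
    case True
    obtain h where h: "h \<in> Lspace S" "\<phi> = proj (defect S c) h" using \<phi> by (auto simp: Ldefect_def)
    have "cinner \<phi> \<phi> = 0" using adj[OF h(1) \<phi>] True h(2) by simp
    then show ?thesis using True by simp
  next
    case False
    define r where "r = norm (proj (Lspace S) \<phi>)"
    have r: "r > 0" using False by (simp add: r_def)
    have "complex_of_real (1 / r) *\<^sub>C \<phi> \<in> B"
      using r by (simp add: B_def Lc.mem_scale \<phi> L.proj_scaleC norm_scaleC norm_divide r_def[symmetric])
    then have "norm (complex_of_real (1 / r) *\<^sub>C \<phi>) \<le> b" by (rule b)
    then show ?thesis using r by (simp add: norm_scaleC norm_divide r_def[symmetric] divide_le_eq)
  qed
  then show ?thesis by blast
qed

text \<open>The image of \<open>Ldefect S c\<close> in \<open>Lspace S\<close> is closed by the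
  bound from below and dense by injectivity of the adjoint map, hence everything.\<close>

lemma Lspace_lift:
  assumes c: "Im c \<noteq> 0"
  shows "\<exists>b\<ge>0. \<forall>l\<in>Lspace S. \<exists>\<phi>\<in>defect S c. proj (Lspace S) \<phi> = l \<and> norm \<phi> \<le> b * norm l"
proof -
  interpret Nc: hilbert_subspace "defect S c" by (rule N_subspace)
  interpret Lc: hilbert_subspace "Ldefect S c" by (rule Ldefect_subspace[OF c])
  obtain b0 where b0: "\<And>\<phi>. \<phi> \<in> Ldefect S c \<Longrightarrow> norm \<phi> \<le> b0 * norm (proj (Lspace S) \<phi>)"
    using Lspace_lift_bounded_below[OF c] by blast
  define b where "b = \<bar>b0\<bar>"
  have b: "norm \<phi> \<le> b * norm (proj (Lspace S) \<phi>)" if "\<phi> \<in> Ldefect S c" for \<phi>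
    unfolding b_def by (rule order_trans[OF b0[OF that] mult_right_mono[OF abs_ge_self norm_ge_zero]])
  define R where "R = proj (Lspace S) ` Ldefect S c"
  have "cvec.subspace R"
    unfolding cvec.subspace_def R_def
    by (auto simp: L.proj_add[symmetric] L.proj_scaleC[symmetric] Lc.mem_add Lc.mem_scale
        intro!: image_eqI[where x = 0] Lc.mem_0 L.proj_ident[symmetric] L.mem_0)
  moreover have "closed R"
    unfolding closed_sequential_limits
  proof (intro allI impI, elim conjE)
    fix X l assume "\<forall>n. X n \<in> R" and X: "X \<longlonglongrightarrow> l"
    then have "\<forall>n. \<exists>\<phi>. \<phi> \<in> Ldefect S c \<and> X n = proj (Lspace S) \<phi>" unfolding R_def by blast
    then obtain \<phi> where \<phi>: "\<And>n. \<phi> n \<in> Ldefect S c" "\<And>n. X n = proj (Lspace S) (\<phi> n)" by metis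
    have "Cauchy \<phi>"
    proof (rule metric_CauchyI)
      fix e :: real assume "0 < e"
      \<comment> \<open>The summand 1 avoids division by zero, since \<open>b\<close> may
        vanish.\<close>
      then have "0 < e / (b + 1)" by (simp add: b_def)
      then obtain N where N: "\<And>m n. m \<ge> N \<Longrightarrow> n \<ge> N \<Longrightarrow> dist (X m) (X n) < e / (b + 1)"
        using metric_CauchyD[OF LIMSEQ_imp_Cauchy[OF X]] by blast
      show "\<exists>N. \<forall>m\<ge>N. \<forall>n\<ge>N. dist (\<phi> m) (\<phi> n) < e"
      proof (intro exI allI impI)
        fix m n assume "N \<le> m" "N \<le> n"
        have "dist (\<phi> m) (\<phi> n) \<le> b * dist (X m) (X n)"
          using b[OF Lc.mem_diff[OF \<phi>(1) \<phi>(1)], of m n] by (simp add: dist_norm \<phi>(2) L.proj_diff)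
        also have "\<dots> \<le> (b + 1) * dist (X m) (X n)" by (simp add: algebra_simps)
        also have "\<dots> < e"
          using N[OF \<open>N \<le> m\<close> \<open>N \<le> n\<close>] by (simp add: b_def pos_less_divide_eq mult.commute)
        finally show "dist (\<phi> m) (\<phi> n) < e" .
      qed
    qed
    then obtain \<psi> where \<psi>: "\<phi> \<longlonglongrightarrow> \<psi>" using Cauchy_convergent_iff convergent_def by blast
    have \<psi>L: "\<psi> \<in> Ldefect S c" using closed_sequentially[OF Lc.closed] \<phi>(1) \<psi> by blast
    have "(\<lambda>n. X n - proj (Lspace S) \<psi>) \<longlonglongrightarrow> 0"
    proof (rule Lim_null_comparison)
      show "\<forall>\<^sub>F n in sequentially. norm (X n - proj (Lspace S) \<psi>) \<le> norm (\<phi> n - \<psi>)"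
        by (simp add: \<phi>(2) L.proj_diff[symmetric] L.norm_proj_le)
      show "(\<lambda>n. norm (\<phi> n - \<psi>)) \<longlonglongrightarrow> 0" using \<psi> by (simp add: LIM_zero tendsto_norm_zero)
    qed
    then have "X \<longlonglongrightarrow> proj (Lspace S) \<psi>" by (rule LIM_zero_cancel)
    then have "l = proj (Lspace S) \<psi>" using X LIMSEQ_unique by blast
    then show "l \<in> R" using \<psi>L by (simp add: R_def)
  qed
  ultimately interpret R: hilbert_subspace R by unfold_locales (simp add: closed_csubspace_def)
  have "l \<in> R" if l: "l \<in> Lspace S" for l
  proof -
    define k where "k = l - proj R l"
    have kR: "cinner k r = 0" if "r \<in> R" for r
      using R.proj_orth[of l] that by (simp add: k_def ominusD)
    have "R \<subseteq> Lspace S" by (auto simp: R_def L.proj_mem)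
    then have k: "k \<in> Lspace S" using l R.proj_mem[of l] L.mem_diff by (auto simp: k_def)
    \<comment> \<open>The residual \<open>k\<close> is tested against the image of its own
      projection: orthogonality to \<open>R\<close> gives \<open>\<phi> = 0\<close>, hence
      \<open>k = 0\<close>.\<close>
    define \<phi> where "\<phi> = proj (defect S c) k"
    have \<phi>: "\<phi> \<in> Ldefect S c" using k by (simp add: \<phi>_def Ldefect_def)
    have "cinner \<phi> \<phi> = cinner k \<phi>"
      unfolding \<phi>_def by (rule Nc.cinner_proj_left[OF Nc.proj_mem])
    also have "\<dots> = cinner k (proj (Lspace S) \<phi>)" by (simp add: L.cinner_proj_right k)
    also have "\<dots> = 0" by (rule kR) (use \<phi> in \<open>auto simp: R_def\<close>)
    finally have "k = 0" using proj_defect_inj[OF c k] by (simp add: \<phi>_def)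
    then show ?thesis using R.proj_mem[of l] by (simp add: k_def)
  qed
  then have "\<exists>\<phi>\<in>defect S c. proj (Lspace S) \<phi> = l \<and> norm \<phi> \<le> b * norm l" if "l \<in> Lspace S" for l
    using that b Ldefect_subset unfolding R_def by blast
  then show ?thesis by (intro exI[of _ b]) (simp add: b_def)
qed

text \<open>The lift \<open>\<phi>\<close> provides the prescribed \<open>Lspace S\<close>
  component; a vector of \<open>H0 S\<close> solving the reduced equation then moves
  \<open>(E - cnj \<mu>) y\<close> into \<open>Lspace S\<close> without disturbing that
  component.\<close>

lemma D_surj_bounded: "\<exists>b. \<forall>l\<in>L\<^sub>0'. \<exists>n\<in>L\<^sub>0. D n = l \<and> norm n \<le> b * norm l"
proof -
  obtain b where b: "b \<ge> 0"
    "\<And>l. l \<in> Lspace S \<Longrightarrow> \<exists>\<phi>\<in>defect S z. proj (Lspace S) \<phi> = l \<and> norm \<phi> \<le> b * norm l"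
    using Lspace_lift[OF nonreal(3)] by blast
  \<comment> \<open>\<open>a\<close> undoes the factor in \<open>D_proj\<close>, \<open>k\<close> is
    the scalar by which \<open>E - cnj \<mu>\<close> acts on \<open>defect S z\<close>, and
    \<open>s\<close> is the denominator in \<open>E_component_bound\<close>.\<close>
  define a where "a = inverse (cnj \<mu> - \<mu>)"
  define k where "k = z - cnj \<mu>"
  define s where "s = sqrt (Im z * Im \<mu>)"
  have s: "s > 0" using Im_z Im_mu by (simp add: s_def)
  interpret Nz: hilbert_subspace "defect S z" by (rule N_subspace)
  have "\<exists>n\<in>L\<^sub>0. D n = l \<and> norm n \<le> cmod k * (cmod k / s + 1) * (b * cmod a) * norm l" if l: "l \<in> L\<^sub>0'" for l
  proof -
    obtain \<phi> where \<phi>: "\<phi> \<in> defect S z" "proj (Lspace S) \<phi> = proj (Lspace S) (a *\<^sub>C l)"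
      "norm \<phi> \<le> b * norm (proj (Lspace S) (a *\<^sub>C l))"
      using b(2)[OF L.proj_mem] by blast
    \<comment> \<open>The negated \<open>H0 S\<close> component of
      \<open>(E - cnj \<mu>) \<phi>\<close>, to be cancelled by adding \<open>w\<close>.\<close>
    define u where "u = - (k *\<^sub>C proj (H0 S) \<phi>)"
    have "u \<in> H0 S" unfolding u_def using H.mem_scale[OF H.proj_mem, of "- k"] by simp
    then obtain w where w: "w \<in> op_dom reduced.E" "app reduced.E w - cnj \<mu> *\<^sub>C w = u"
      using reduced.E_surj[OF Im_mu] by blast
    obtain f \<psi> where f: "f \<in> op_dom S" "\<psi> \<in> semi_defect S z" "w = f + \<psi>"
      using w(1) unfolding reduced.dom_E by (auto simp: reduced_M)
    have \<psi>: "\<psi> \<in> defect S z" "\<psi> \<in> H0 S" using f(2) semi_defect_subset by auto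
    define y where "y = f + (\<psi> + \<phi>)"
    have sum: "\<psi> + \<phi> \<in> full.M z" by (simp add: full_M Nz.mem_add \<psi> \<phi>)
    have y: "y \<in> op_dom full.E" unfolding y_def by (rule full.dom_EI[OF f(1) sum])
    define h where "h = app full.E y - cnj \<mu> *\<^sub>C y"
    have h_eq: "h = app S f - cnj \<mu> *\<^sub>C f + k *\<^sub>C (\<psi> + \<phi>)"
      by (simp add: h_def y_def full.app_E[OF f(1) sum] k_def scaleC_simps)
    have u_eq: "u = app (S0 S) f - cnj \<mu> *\<^sub>C f + k *\<^sub>C \<psi>"
      using reduced.app_E[of f \<psi>] f by (simp add: w(2)[symmetric] reduced_M k_def scaleC_simps)
    have "proj (H0 S) h = u + k *\<^sub>C proj (H0 S) \<phi>"
      unfolding h_eq u_eq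
      by (simp add: H.proj_add H.proj_diff H.proj_scaleC H.proj_ident \<psi> dom_H0 f(1) scaleC_simps)
    then have h: "h \<in> Lspace S" by (simp add: Lspace_iff u_def)
    note D = D_proj[OF h y h_def[symmetric]]
    define n where "n = proj N h"
    have n: "n \<in> L\<^sub>0" using h by (simp add: n_def Ldefect_def)
    have "proj (Lspace S) w = 0"
      using reduced.dom_E_mem[OF w(1)] by (simp add: H0_iff)
    then have py: "proj (Lspace S) y = proj (Lspace S) (a *\<^sub>C l)"
      using \<phi>(2) L.proj_add[of w \<phi>] by (simp add: y_def f(3) add.assoc)
    have "proj (Lspace S) ((cnj \<mu> - \<mu>) *\<^sub>C y) = proj (Lspace S) l"
      using nonreal(4) by (simp add: L.proj_scaleC py a_def scaleC_scaleC scaleC_one)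
    then have "(cnj \<mu> - \<mu>) *\<^sub>C y - l \<in> H0 S" by (simp add: H0_iff L.proj_diff)
    \<comment> \<open>The error lies in \<open>N'\<close> and in \<open>H0 S\<close>, hence in
      \<open>M\<^sub>0'\<close>, where \<open>proj L\<^sub>0'\<close> vanishes.\<close>
    then have "(cnj \<mu> - \<mu>) *\<^sub>C y - l \<in> M\<^sub>0'"
      using N'.mem_diff[OF D(2) L0'_N'[OF l]] by (simp add: semi_defect_eq)
    from proj_Ldefect_semi_defect[OF nonreal(2) this]
    have Dn: "D n = l" using D(1) by (simp add: n_def L0'.proj_diff L0'.proj_ident l)
    \<comment> \<open>The range part of \<open>h\<close> projects to zero, so \<open>\<psi>\<close>
      and \<open>\<phi>\<close> alone control the norm of \<open>n\<close>.\<close>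
    have "n = proj N (k *\<^sub>C (\<psi> + \<phi>))" unfolding n_def h_eq by (rule proj_defect_ran[OF f(1)])
    then have "norm n \<le> cmod k * norm (\<psi> + \<phi>)" using N.norm_proj_le by (metis norm_scaleC)
    also have "\<dots> \<le> cmod k * (norm \<psi> + norm \<phi>)" by (intro mult_left_mono norm_triangle_ineq) simp
    also have "\<dots> \<le> cmod k * (cmod k / s * norm \<phi> + norm \<phi>)"
    proof -
      have "norm \<psi> \<le> norm u / s"
        unfolding s_def
        by (rule reduced.E_component_bound[of f]) (use f w Im_mu in \<open>auto simp: reduced_M\<close>)
      also have "\<dots> \<le> cmod k * norm \<phi> / s"
        using s by (intro divide_right_mono) (auto simp: u_def norm_scaleC H.norm_proj_le mult_left_mono)
      finally show ?thesis by (intro mult_left_mono) auto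
    qed
    also have "\<dots> = cmod k * (cmod k / s + 1) * norm \<phi>" by (simp add: algebra_simps)
    also have "\<dots> \<le> cmod k * (cmod k / s + 1) * (b * (cmod a * norm l))"
    proof (rule mult_left_mono)
      have "norm (proj (Lspace S) (a *\<^sub>C l)) \<le> cmod a * norm l"
        using L.norm_proj_le by (metis norm_scaleC)
      then show "norm \<phi> \<le> b * (cmod a * norm l)" using \<phi>(3) b(1) by (meson mult_left_mono order_trans)
    qed (use s in auto)
    finally have "norm n \<le> cmod k * (cmod k / s + 1) * (b * cmod a) * norm l" by (simp add: mult.assoc)
    with n Dn show ?thesis by blast
  qed
  then show ?thesis by blast
qed

section \<open>Bijectivity and bounded inverse of the corner\<close>

lemma D_inj: "inj_on D L\<^sub>0"
proof (rule inj_onI)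
  fix x y assume xy: "x \<in> L\<^sub>0" "y \<in> L\<^sub>0" "D x = D y"
  have "D (x - y) = 0" using D_add[of "x - y" y] xy by (simp add: L0.mem_diff)
  then have "x - y = 0" by (rule D_kernel[OF L0.mem_diff[OF xy(1,2)]])
  then show "x = y" by simp
qed

lemma D_bij: "bij_betw D L\<^sub>0 L\<^sub>0'"
  using D_inj D_mem D_surj_bounded by (auto simp: bij_betw_def)

lemma D_inv_bounded: "inv_into L\<^sub>0 D \<in> bounded_operators L\<^sub>0' L\<^sub>0"
proof -
  obtain b where b: "\<And>l. l \<in> L\<^sub>0' \<Longrightarrow> \<exists>n\<in>L\<^sub>0. D n = l \<and> norm n \<le> b * norm l"
    using D_surj_bounded by blast
  have "norm x \<le> b * norm (D x)" if "x \<in> L\<^sub>0" for x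
    using b[OF D_mem[OF that]] D_inj that by (auto dest: inj_onD)
  then show ?thesis by (intro inverse_bounded_operator[OF L0.sub D_bij] D_add D_scaleC)
qed

lemma D_inv_mem: "x \<in> L\<^sub>0' \<Longrightarrow> inv_into L\<^sub>0 D x \<in> L\<^sub>0"
  and D_D_inv: "x \<in> L\<^sub>0' \<Longrightarrow> D (inv_into L\<^sub>0 D x) = x"
  and D_inv_D: "y \<in> L\<^sub>0 \<Longrightarrow> inv_into L\<^sub>0 D (D y) = y"
  using D_bij by (auto simp: bij_betw_def intro: inv_into_into f_inv_into_f)

section \<open>Block form, Schur complement and triangular factorization\<close>

lemma C_S_split:
  assumes "\<phi> \<in> N"
  shows "C_S S \<mu> z \<phi> = proj L\<^sub>0' (C_S S \<mu> z \<phi>) + proj M\<^sub>0' (C_S S \<mu> z \<phi>)"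
  using defect_proj_sum[OF nonreal(2) C_mem[OF assms]] by simp

text \<open>For \<open>D n = A12 \<phi>\<close> the correction \<open>(C - V) n\<close> removes the
  component of \<open>C \<phi>\<close> in \<open>L\<^sub>0'\<close>. This puts \<open>w\<close> into
  \<open>H0 S\<close>, where the reduced extension is the compression of the full one.\<close>

lemma schur_complement:
  assumes \<phi>: "\<phi> \<in> M\<^sub>0"
  shows "C_S0 S \<mu> z \<phi> = A22 S \<mu> z \<phi> - A21 S \<mu> z (inv_into L\<^sub>0 D (A12 S \<mu> z \<phi>))"
proof -
  have \<phi>N: "\<phi> \<in> N" by (rule M0_N[OF \<phi>])
  have A12: "A12 S \<mu> z \<phi> = proj L\<^sub>0' (C_S S \<mu> z \<phi>)" using \<phi> by (simp add: A12_def)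
  define n where "n = inv_into L\<^sub>0 D (A12 S \<mu> z \<phi>)"
  have n: "n \<in> L\<^sub>0" "D n = proj L\<^sub>0' (C_S S \<mu> z \<phi>)"
    by (simp_all add: n_def A12 D_inv_mem D_D_inv L0'.proj_mem)
  obtain h where h: "h \<in> Lspace S" "n = proj N h" using n(1) by (auto simp: Ldefect_def)
  obtain y where y: "y \<in> op_dom full.E" "app full.E y - cnj \<mu> *\<^sub>C y = h"
    using full.E_surj[OF Im_mu, of h] by auto
  obtain x where x: "x \<in> op_dom full.E" "app full.E x - cnj \<mu> *\<^sub>C x = \<phi>"
    using full.E_surj[OF Im_mu, of \<phi>] by auto
  define w where "w = x - y"
  have w: "w \<in> op_dom full.E" "app full.E w - cnj \<mu> *\<^sub>C w = \<phi> - h"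
    unfolding w_def using x y by (auto simp: full.E_dom full.E_lin scaleC_simps)
  define \<psi> where "\<psi> = C_S S \<mu> z \<phi> - (C_S S \<mu> z n - V S \<mu> n)"
  have \<psi>_eq: "\<psi> = \<phi> + (cnj \<mu> - \<mu>) *\<^sub>C w"
    using C_S_minus_V[OF h(1) y] C_S_eq[OF \<phi>N x] by (simp add: \<psi>_def h(2) w_def scaleC_simps)
  have \<psi>N: "\<psi> \<in> N'"
    unfolding \<psi>_def by (intro N'.mem_diff C_mem \<phi>N L0_N n(1) L0'_N' V_mem')
  have "proj L\<^sub>0' \<psi> = 0" by (simp add: \<psi>_def L0'.proj_diff[of "C_S S \<mu> z \<phi>"] D_eq[OF n(1), symmetric] n(2))
  then have \<psi>M: "\<psi> = proj M\<^sub>0' \<psi>" using defect_proj_sum[OF nonreal(2) \<psi>N] by simp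
  then have "\<psi> \<in> H0 S" using M0'.proj_mem[of \<psi>] semi_defect_subset by auto
  moreover have \<phi>H: "\<phi> \<in> H0 S" using \<phi> semi_defect_subset by auto
  ultimately have "inverse (cnj \<mu> - \<mu>) *\<^sub>C (\<psi> - \<phi>) \<in> H0 S" by (intro H.mem_scale H.mem_diff)
  then have wH: "w \<in> H0 S" using nonreal(4) by (simp add: \<psi>_eq scaleC_scaleC scaleC_one)
  obtain f \<eta> where f: "f \<in> op_dom S" "\<eta> \<in> full.M z" "w = f + \<eta>"
    using w(1) by (auto simp: full.dom_E)
  \<comment> \<open>A vector of \<open>defect S z\<close> in \<open>H0 S\<close> is in
    \<open>semi_defect S z\<close>, so the decomposition of \<open>w\<close> also serves the reduced
    extension.\<close>
  have "\<eta> \<in> H0 S" using H.mem_diff[OF wH dom_H0[OF f(1)]] by (simp add: f(3))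
  then have \<eta>: "\<eta> \<in> reduced.M z" using f(2) by (simp add: reduced_M full_M semi_defect_eq)
  have wE: "w \<in> op_dom reduced.E" unfolding f(3) using f(1) \<eta> by (intro reduced.dom_EI) auto
  have "app reduced.E w - cnj \<mu> *\<^sub>C w = proj (H0 S) (app full.E w - cnj \<mu> *\<^sub>C w)"
    using reduced.app_E[of f \<eta>] full.app_E[OF f(1,2)] f(1) \<eta> \<open>\<eta> \<in> H0 S\<close> wH
    by (simp add: f(3)[symmetric] H.proj_diff H.proj_add H.proj_scaleC H.proj_ident)
  also have "\<dots> = \<phi>"
    using h(1) by (simp add: w(2) H.proj_diff H.proj_ident \<phi>H Lspace_iff)
  finally have "C_S0 S \<mu> z \<phi> = \<psi>"
    using reduced.char_fun_eq[OF Im_mu _ wE, of \<phi>] \<phi> by (simp add: C_S0_def reduced_M \<psi>_eq)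
  \<comment> \<open>\<open>V S \<mu> n\<close> lies in \<open>L\<^sub>0'\<close> and has no
    component in \<open>M\<^sub>0'\<close>.\<close>
  also have "\<psi> = A22 S \<mu> z \<phi> - A21 S \<mu> z n"
    by (subst \<psi>M) (simp add: \<psi>_def M0'.proj_diff A22_def A21_def \<phi> n(1)
        proj_semi_defect_Ldefect[OF nonreal(2) V_mem'])
  finally show ?thesis by (simp add: n_def)
qed

lemma block_representation:
  assumes "\<phi> \<in> N"
  shows "C_S S \<mu> z \<phi> = block_op L\<^sub>0 M\<^sub>0 (A11 S \<mu> z) (A12 S \<mu> z) (A21 S \<mu> z) (A22 S \<mu> z) \<phi>"
proof -
  define p q where "p = proj L\<^sub>0 \<phi>" and "q = proj M\<^sub>0 \<phi>"
  have pq: "p \<in> L\<^sub>0" "q \<in> M\<^sub>0" "\<phi> = p + q"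
    using defect_proj_sum[OF nonreal(1) assms] by (simp_all add: p_def q_def L0.proj_mem M0.proj_mem)
  have "C_S S \<mu> z \<phi> = C_S S \<mu> z p + C_S S \<mu> z q"
    unfolding pq(3) by (intro C_add L0_N M0_N pq)
  also have "\<dots> = (proj L\<^sub>0' (C_S S \<mu> z p) + proj M\<^sub>0' (C_S S \<mu> z p))
      + (proj L\<^sub>0' (C_S S \<mu> z q) + proj M\<^sub>0' (C_S S \<mu> z q))"
    using C_S_split[OF L0_N[OF pq(1)]] C_S_split[OF M0_N[OF pq(2)]] by simp
  also have "\<dots> = block_op L\<^sub>0 M\<^sub>0 (A11 S \<mu> z) (A12 S \<mu> z) (A21 S \<mu> z) (A22 S \<mu> z) \<phi>"
    using pq(1,2) by (simp add: block_op_def p_def[symmetric] q_def[symmetric] A11_def A12_def A21_def A22_def)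
  finally show ?thesis .
qed

lemma block_representation_minus_V:
  assumes "\<phi> \<in> N"
  shows "C_S S \<mu> z \<phi> - V S \<mu> (proj L\<^sub>0 \<phi>)
    = block_op L\<^sub>0 M\<^sub>0 D (A12 S \<mu> z) (A21 S \<mu> z) (A22 S \<mu> z) \<phi>"
  by (simp add: block_representation[OF assms] block_op_def D_def)

text \<open>\<open>block_op\<close> adds its rows, so composing block matrices requires getting them
  back; projecting to the orthogonal summands separates them.\<close>

lemma block_op_components:
  assumes c: "Im c \<noteq> 0"
    and "A (proj (Ldefect S c) x) + B (proj (semi_defect S c) x) \<in> Ldefect S d"
    and "P (proj (Ldefect S c) x) + Q (proj (semi_defect S c) x) \<in> semi_defect S d"
    and d: "Im d \<noteq> 0"
  shows "proj (Ldefect S d) (block_op (Ldefect S c) (semi_defect S c) A B P Q x)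
      = A (proj (Ldefect S c) x) + B (proj (semi_defect S c) x)"
    and "proj (semi_defect S d) (block_op (Ldefect S c) (semi_defect S c) A B P Q x)
      = P (proj (Ldefect S c) x) + Q (proj (semi_defect S c) x)"
  using assms hilbert_subspace.proj_ident[OF Ldefect_subspace[OF d]]
    hilbert_subspace.proj_ident[OF M_subspace]
  by (simp_all add: block_op_def hilbert_subspace.proj_add[OF Ldefect_subspace[OF d], of "A _ + B _"]
      hilbert_subspace.proj_add[OF M_subspace, of _ "A _ + B _"]
      proj_Ldefect_semi_defect proj_semi_defect_Ldefect)

text \<open>From the right, \<open>(p, q)\<close> becomes \<open>(p + e, q)\<close> and then
  \<open>(D (p + e), C_S0 q)\<close>. Here \<open>D e = A12 q\<close> completes the first row, and
  the Schur formula turns \<open>A21 e + C_S0 q\<close> into \<open>A22 q\<close>.\<close>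

lemma frobenius_schur_factorization:
  assumes "\<phi> \<in> N"
  shows "C_S S \<mu> z \<phi> - V S \<mu> (proj L\<^sub>0 \<phi>) =
      (block_op L\<^sub>0' M\<^sub>0' id (\<lambda>_. 0) (A21 S \<mu> z \<circ> inv_into L\<^sub>0 D) id
       \<circ> block_op L\<^sub>0 M\<^sub>0 D (\<lambda>_. 0) (\<lambda>_. 0) (C_S0 S \<mu> z)
       \<circ> block_op L\<^sub>0 M\<^sub>0 id (inv_into L\<^sub>0 D \<circ> A12 S \<mu> z) (\<lambda>_. 0) id) \<phi>"
proof -
  define p q where "p = proj L\<^sub>0 \<phi>" and "q = proj M\<^sub>0 \<phi>"
  have pq: "p \<in> L\<^sub>0" "q \<in> M\<^sub>0" by (simp_all add: p_def q_def L0.proj_mem M0.proj_mem)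
  define e where "e = inv_into L\<^sub>0 D (A12 S \<mu> z q)"
  have A12: "A12 S \<mu> z q \<in> L\<^sub>0'" using pq by (simp add: A12_def L0'.proj_mem)
  have e: "e \<in> L\<^sub>0" "D e = A12 S \<mu> z q" by (simp_all add: e_def A12 D_inv_mem D_D_inv)
  have pe: "p + e \<in> L\<^sub>0" using pq e by (simp add: L0.mem_add)
  define x where "x = block_op L\<^sub>0 M\<^sub>0 id (inv_into L\<^sub>0 D \<circ> A12 S \<mu> z) (\<lambda>_. 0) id \<phi>"
  have x: "proj L\<^sub>0 x = p + e" "proj M\<^sub>0 x = q"
    unfolding x_def
    using block_op_components[OF nonreal(1) _ _ nonreal(1), of id \<phi> "inv_into L\<^sub>0 D \<circ> A12 S \<mu> z" "\<lambda>_. 0" id]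
      pq pe by (simp_all add: p_def[symmetric] q_def[symmetric] e_def[symmetric])
  define y where "y = block_op L\<^sub>0 M\<^sub>0 D (\<lambda>_. 0) (\<lambda>_. 0) (C_S0 S \<mu> z) x"
  have C0: "C_S0 S \<mu> z q \<in> M\<^sub>0'" using C_S0_bounded pq(2) by (auto simp: bounded_operators_def)
  have y: "proj L\<^sub>0' y = D (p + e)" "proj M\<^sub>0' y = C_S0 S \<mu> z q"
    unfolding y_def
    using block_op_components[OF nonreal(1) _ _ nonreal(2), of D x "\<lambda>_. 0" "\<lambda>_. 0" "C_S0 S \<mu> z"]
      C0 D_mem[OF pe] by (simp_all add: x)
  have A21: "A21 S \<mu> z (p + e) = A21 S \<mu> z p + A21 S \<mu> z e"
    using pq(1) e(1) pe by (simp add: A21_def C_add L0_N M0'.proj_add)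
  have "block_op L\<^sub>0' M\<^sub>0' id (\<lambda>_. 0) (A21 S \<mu> z \<circ> inv_into L\<^sub>0 D) id y
      = D (p + e) + (A21 S \<mu> z (p + e) + C_S0 S \<mu> z q)"
    by (simp add: block_op_def y D_inv_D pe)
  also have "\<dots> = D p + A12 S \<mu> z q + (A21 S \<mu> z p + A22 S \<mu> z q)"
    using schur_complement[OF pq(2)] by (simp add: D_add pq e A21 e_def[symmetric])
  also have "\<dots> = C_S S \<mu> z \<phi> - V S \<mu> (proj L\<^sub>0 \<phi>)"
    unfolding block_representation_minus_V[OF assms] by (simp add: block_op_def p_def q_def)
  finally show ?thesis by (simp add: x_def[symmetric] y_def[symmetric])
qed

end

text \<open>\<open>inv_into\<close> is total, so the clauses on bijectivity and boundedness are what
  make \<open>D_inv\<close> the bounded inverse of the corner in the formulas.\<close>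

theorem proposition10p2:
  fixes S :: "'a::complex_hilbert operator" and \<mu> z :: complex
  assumes "separable TYPE('a)" and "infinite_dimensional TYPE('a)"
    and "linear_op S" and "closed_op S" and "symmetric_op S"
    and "closure (op_dom S) \<noteq> UNIV"
    and "regular S"
    and "semi_index_plus S \<noteq> 0" and "semi_index_minus S \<noteq> 0"
    and "Im \<mu> > 0" and "Im z > 0"
  shows
    "let L = Ldefect S \<mu>; L' = Ldefect S (cnj \<mu>);
         M = semi_defect S \<mu>; M' = semi_defect S (cnj \<mu>);
         A\<^sub>1\<^sub>1 = A11 S \<mu> z; A\<^sub>1\<^sub>2 = A12 S \<mu> z; A\<^sub>2\<^sub>1 = A21 S \<mu> z; A\<^sub>2\<^sub>2 = A22 S \<mu> z;
         D = (\<lambda>x. A\<^sub>1\<^sub>1 x - V S \<mu> x);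
         D_inv = inv_into L D
     in C_S S \<mu> z \<in> bounded_operators (defect S \<mu>) (defect S (cnj \<mu>))
      \<and> C_S0 S \<mu> z \<in> bounded_operators M M'
      \<and> bij_betw D L L' \<and> D_inv \<in> bounded_operators L' L
      \<and> (\<forall>\<phi>\<in>defect S \<mu>. C_S S \<mu> z \<phi> = block_op L M A\<^sub>1\<^sub>1 A\<^sub>1\<^sub>2 A\<^sub>2\<^sub>1 A\<^sub>2\<^sub>2 \<phi>)
      \<and> (\<forall>\<phi>\<in>defect S \<mu>.
           C_S S \<mu> z \<phi> - V S \<mu> (proj L \<phi>) = block_op L M D A\<^sub>1\<^sub>2 A\<^sub>2\<^sub>1 A\<^sub>2\<^sub>2 \<phi>)
      \<and> (\<forall>\<phi>\<in>M. C_S0 S \<mu> z \<phi> = A\<^sub>2\<^sub>2 \<phi> - A\<^sub>2\<^sub>1 (D_inv (A\<^sub>1\<^sub>2 \<phi>)))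
      \<and> (\<forall>\<phi>\<in>defect S \<mu>.
           C_S S \<mu> z \<phi> - V S \<mu> (proj L \<phi>) =
             (block_op L' M' id (\<lambda>_. 0) (A\<^sub>2\<^sub>1 \<circ> D_inv) id
              \<circ> block_op L M D (\<lambda>_. 0) (\<lambda>_. 0) (C_S0 S \<mu> z)
              \<circ> block_op L M id (D_inv \<circ> A\<^sub>1\<^sub>2) (\<lambda>_. 0) id) \<phi>)"
proof -
  interpret regular_symmetric_pair S \<mu> z using assms by unfold_locales
  have D_fun: "(\<lambda>x. A11 S \<mu> z x - V S \<mu> x) = D" by (simp add: fun_eq_iff D_def)
  show ?thesis
    unfolding Let_def D_fun
    using C_S_bounded C_S0_bounded D_bij D_inv_bounded block_representation
      block_representation_minus_V schur_complement frobenius_schur_factorization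
    by (intro conjI ballI)
qed

end
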